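(* Assume that conditions (L1), (R1), (R2), (R3) and (R4) listed in the context are satisfied. Assume further that there exist a deterministic configuration $\eta\in\Omega$ and a non-increasing function $F\colon[0,\infty)\to\mathbb{R}$ with $F(t)\downarrow0$ as $t\uparrow\infty$ such that for any $h>0$ there exists $\mu^h\in\mathcal{M}_1(\Omega)$, stationary for $(S^h(t))_{t\ge0}$, with $$|S^h(t)f(\eta)-\mu^h(f)|\le C(f)\,F(t)\qquad\text{for all local } f\colon\Omega\to\mathbb{R}\text{ and all }t\ge0,$$ where the constant $C(f)$ may depend on $f$ but not on $h$. Then $(\mu^h)_{h>0}$ converges weakly, as $h\to\infty$, to a limit $\mu^*\in\mathcal{M}_1(\Omega)$, and $\mu^*$ is stationary for the infinite-volume dynamics $(S(t))_{t\ge0}$, i.e. $\mu^*S(t)=\mu^*$ for all $t\ge0$.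
   Context: Let $S$ be a countably infinite set with a metric $d$, $q\in\mathbb{N}$, $\Omega=\{0,\dots,q-1\}^S$ with the product topology and Borel $\sigma$-algebra, $\Omega_\Delta=\{0,\dots,q-1\}^\Delta$ for $\Delta\subset S$. $\mathcal{M}_1(\Omega)$ is the set of Borel probability measures on $\Omega$ and $C(\Omega)$ the space of continuous functions $\Omega\to\mathbb{R}$. A function $f$ is local if there is a finite $\Lambda'\subset S$ such that $f(\eta)$ depends only on the restriction $\eta_{\Lambda'}$. For $\xi_\Delta\in\Omega_\Delta$, $\xi_\Delta\eta_{\Delta^c}$ is the configuration equal to $\xi_\Delta$ on $\Delta$ and to $\eta$ off $\Delta$. The oscillation of $f$ at $x\in S$ is $\delta_x(f)=\sup\{|f(\eta)-f(\xi)|\colon \eta=\xi\text{ off }x\}$, and $D(\Omega)=\{f\in C(\Omega)\colon\sum_{x\in S}\delta_x(f)<\infty\}$. Rates: for each finite $\Delta\subset S$ and $\xi_\Delta\in\Omega_\Delta$ let $c_\Delta(\cdot,\xi_\Delta)\colon\Omega\to[0,\infty)$ be continuous. The generator is $$\mathscr{L}f(\eta)=\sum_{\Delta\subset S\text{ finite}}\ \sum_{\xi_\Delta\in\Omega_\Delta}c_\Delta(\eta,\xi_\Delta)\,[f(\xi_\Delta\eta_{\Delta^c})-f(\eta)],\quad f\in D(\Omega).$$ For $x\ne y$ put $\gamma(x,y)=\sum_{\Delta\ni x}\sum_{\xi_\Delta\in\Omega_\Delta}\delta_y(c_\Delta(\cdot,\xi_\Delta))$, and $\gamma(x,x)=0$.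 Let $\varrho\colon[0,\infty)\to(0,\infty)$ be non-increasing and $L>0$ a constant. Conditions: (L1) $\mathbf{C}_1:=\sup_{x\in S}\sum_{\Delta\ni x}\sum_{\xi_\Delta}\|c_\Delta(\cdot,\xi_\Delta)\|_\infty<\infty$. (R1) $c_\Delta\equiv0$ whenever $\mathrm{diam}(\Delta)\ge L$. (R2) There is a constant $\mathbf{C}_\varrho\in(0,\infty)$ with $\varrho(d(x,z))\varrho(d(z,y))\le\mathbf{C}_\varrho\,\varrho(d(x,y))$ for all $x,y,z\in S$. (R3) $\mathbf{C}_\gamma:=\sup_{x\in S}\sum_{y\in S}\frac{\gamma(x,y)}{\varrho(d(x,y))}<\infty$. (R4) $\sup_{x\in S}\sum_{y\in S}\varrho(d(x,y))<\infty$. Under (L1) and (R3) (which gives $\sup_x\sum_{y\neq x}\gamma(x,y)<\infty$), $\mathscr{L}$ with core $D(\Omega)$ generates a unique Markov (Feller) semigroup $(S(t))_{t\ge0}$ on $C(\Omega)$. $\mu S(t)$ denotes the law with $\mu S(t)(f)=\mu(S(t)f)$. Restriction: fix a nonempty finite $\Lambda\subset S$. For $h>0$ let $\Lambda^h=\{u\in S\colon\inf_{v\in\Lambda}d(u,v)\le h\}$, and let $(S^h(t))_{t\ge0}$ be the semigroup generated by $$\mathscr{L}^hf(\eta)=\sum_{\Delta\subset\Lambda^h}\sum_{\xi_\Delta\in\Omega_\Delta}c_\Delta(\eta,\xi_\Delta)[f(\xi_\Delta\eta_{\Delta^c})-f(\eta)].$$ Thus only sites in $\Lambda^h$ are updated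 and all others stay frozen. A measure $\nu$ is stationary for $(S^h(t))_{t\ge0}$ if $\nu S^h(t)=\nu$ for all $t\ge0$. *)

theory Defs
  imports "HOL-Probability.Probability"
begin

section \<open>Configurations and observables\<close>

text \<open>
  The spin alphabet with q elements is a finite type \<open>'q\<close> carrying the discrete topology, so that
  \<open>'s \<Rightarrow> 'q\<close> with the function topology and its Borel sigma-algebra is the configuration space.
  Since it is compact, \<open>('s \<Rightarrow> 'q) \<Rightarrow>\<^sub>C real\<close> is the space of all continuous functions with the
  supremum norm (\<open>continuous_mem_bcontfun\<close> below). The metric on the sites is the one
  of the class \<open>metric_space\<close>; the topology it induces on the sites plays no role.
\<close>

type_synonym ('s, 'q) config = "'s \<Rightarrow> 'q"
type_synonym ('s, 'q) obs = "('s \<Rightarrow> 'q) \<Rightarrow>\<^sub>C real"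

lemma compact_configs:
  "compact (UNIV :: ('s \<Rightarrow> 'q::{finite, discrete_topology}) set)"
proof -
  have "compact_space (euclidean :: 'q topology)"
    by (simp add: compact_space_def finite_imp_compact)
  then have "compact_space (product_topology (\<lambda>_. euclidean :: 'q topology) (UNIV :: 's set))"
    by (simp add: compact_space_product_topology)
  then show ?thesis
    by (metis compact_space_def compactin_euclidean_iff euclidean_product_topology topspace_euclidean)
qed

lemma continuous_mem_bcontfun:
  fixes f :: "('s \<Rightarrow> 'q::{finite, discrete_topology}) \<Rightarrow> real"
  assumes "continuous_on UNIV f"
  shows "f \<in> bcontfun"
  using assms compact_configs compact_continuous_image compact_imp_bounded
  by (auto simp: bcontfun_def)

definition local_fun :: "(('s \<Rightarrow> 'q) \<Rightarrow> real) \<Rightarrow> bool" where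
  "local_fun f \<longleftrightarrow> (\<exists>\<Lambda>. finite \<Lambda> \<and> (\<forall>\<eta> \<xi>. (\<forall>x\<in>\<Lambda>. \<eta> x = \<xi> x) \<longrightarrow> f \<eta> = f \<xi>))"

text \<open>Local functions are automatically continuous, so quantifying over local elements of
  \<open>('s, 'q) obs\<close> is the same as quantifying over all local functions.\<close>

lemma local_fun_mem_bcontfun:
  fixes f :: "('s \<Rightarrow> 'q::{finite, discrete_topology}) \<Rightarrow> real"
  assumes "local_fun f"
  shows "f \<in> bcontfun"
proof (rule continuous_mem_bcontfun)
  obtain \<Lambda> where \<Lambda>: "finite \<Lambda>" "\<And>\<eta> \<xi>. (\<forall>x\<in>\<Lambda>. \<eta> x = \<xi> x) \<Longrightarrow> f \<eta> = f \<xi>"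
    using assms unfolding local_fun_def by blast
  have "\<exists>T. open T \<and> \<eta> \<in> T \<and> (\<forall>\<xi>\<in>T. f \<xi> = f \<eta>)" for \<eta>
  proof (intro exI conjI ballI)
    let ?T = "Pi\<^sub>E UNIV (\<lambda>x. if x \<in> \<Lambda> then {\<eta> x} else UNIV)"
    have "finite {x. (if x \<in> \<Lambda> then {\<eta> x} else UNIV) \<noteq> UNIV}"
      by (rule finite_subset[OF _ \<Lambda>(1)]) auto
    then show "open ?T"
      by (intro open_PiE) (auto simp: discrete_topology_class.open_discrete)
    show "\<eta> \<in> ?T" by auto
    show "f \<xi> = f \<eta>" if "\<xi> \<in> ?T" for \<xi>
      using that by (intro \<Lambda>(2)) (auto simp: PiE_iff split: if_splits)
  qed
  then have ev: "eventually (\<lambda>\<xi>. f \<xi> = f \<eta>) (nhds \<eta>)" for \<eta>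
    by (simp add: eventually_nhds)
  have "(f \<longlongrightarrow> f \<eta>) (at \<eta>)" for \<eta>
    by (intro tendsto_eventually, unfold eventually_at_filter) (rule eventually_mono[OF ev], simp)
  then show "continuous_on UNIV f"
    by (simp add: continuous_on_def)
qed

definition oscillation :: "'s \<Rightarrow> ('s, 'q::topological_space) obs \<Rightarrow> ennreal" where
  "oscillation x f = (SUP (\<eta>, \<xi>) \<in> {(\<eta>, \<xi>). \<forall>y. y \<noteq> x \<longrightarrow> \<eta> y = \<xi> y}. ennreal \<bar>f \<eta> - f \<xi>\<bar>)"

definition smooth_obs :: "('s, 'q::topological_space) obs set" where
  "smooth_obs = {f. (\<Sum>\<^sub>\<infinity>x. oscillation x f) < \<infinity>}"

section \<open>Rates and generators\<close>

text \<open>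
  \<open>c \<Delta> \<xi>\<close> is the continuous function \<open>c\<^sub>\<Delta>(\<cdot>, \<xi>\<^sub>\<Delta>)\<close>. Local configurations on \<open>\<Delta>\<close> are
  extensional functions; values of \<open>c\<close> at other arguments or at infinite \<open>\<Delta>\<close> are never used.
\<close>

type_synonym ('s, 'q) rates = "'s set \<Rightarrow> ('s \<Rightarrow> 'q) \<Rightarrow> ('s, 'q) obs"

definition local_configs :: "'s set \<Rightarrow> ('s \<Rightarrow> 'q) set" where
  "local_configs \<Delta> = (\<Delta> \<rightarrow>\<^sub>E UNIV)"

definition nonneg_rates :: "('s, 'q::topological_space) rates \<Rightarrow> bool" where
  "nonneg_rates c \<longleftrightarrow> (\<forall>\<Delta>. finite \<Delta> \<longrightarrow> (\<forall>\<xi>\<in>local_configs \<Delta>. \<forall>\<eta>. 0 \<le> c \<Delta> \<xi> \<eta>))"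

text \<open>The generator in which only the updates of finite \<open>\<Delta> \<subseteq> V\<close> are kept: \<open>V = UNIV\<close> gives the
  infinite-volume generator. On \<open>smooth_obs\<close> the series converges absolutely under (L1).\<close>

definition generator ::
    "('s, 'q::topological_space) rates \<Rightarrow> 's set \<Rightarrow> ('s, 'q) obs \<Rightarrow> ('s, 'q) config \<Rightarrow> real" where
  "generator c V f \<eta> =
     (\<Sum>\<^sub>\<infinity>\<Delta>\<in>{\<Delta>. finite \<Delta> \<and> \<Delta> \<subseteq> V}. \<Sum>\<xi>\<in>local_configs \<Delta>.
        c \<Delta> \<xi> \<eta> * (f (override_on \<eta> \<xi> \<Delta>) - f \<eta>))"

definition influence :: "('s, 'q::topological_space) rates \<Rightarrow> 's \<Rightarrow> 's \<Rightarrow> ennreal" where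
  "influence c x y = (if x = y then 0 else
     (\<Sum>\<^sub>\<infinity>\<Delta>\<in>{\<Delta>. finite \<Delta> \<and> x \<in> \<Delta>}. \<Sum>\<xi>\<in>local_configs \<Delta>. oscillation y (c \<Delta> \<xi>)))"

definition cond_L1 :: "('s, 'q::topological_space) rates \<Rightarrow> bool" where
  "cond_L1 c \<longleftrightarrow>
     (SUP x. \<Sum>\<^sub>\<infinity>\<Delta>\<in>{\<Delta>. finite \<Delta> \<and> x \<in> \<Delta>}. \<Sum>\<xi>\<in>local_configs \<Delta>. ennreal (norm (c \<Delta> \<xi>))) < \<infinity>"

definition cond_R1 :: "('s::metric_space, 'q::topological_space) rates \<Rightarrow> real \<Rightarrow> bool" where
  "cond_R1 c L \<longleftrightarrow>
     (\<forall>\<Delta>. finite \<Delta> \<and> diameter \<Delta> \<ge> L \<longrightarrow> (\<forall>\<xi>\<in>local_configs \<Delta>. c \<Delta> \<xi> = 0))"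

definition cond_R2 :: "'s::metric_space itself \<Rightarrow> (real \<Rightarrow> real) \<Rightarrow> bool" where
  "cond_R2 _ \<rho> \<longleftrightarrow>
     (\<exists>K>0. \<forall>x y z :: 's. \<rho> (dist x z) * \<rho> (dist z y) \<le> K * \<rho> (dist x y))"

definition cond_R3 ::
    "('s::metric_space, 'q::topological_space) rates \<Rightarrow> (real \<Rightarrow> real) \<Rightarrow> bool" where
  "cond_R3 c \<rho> \<longleftrightarrow> (SUP x. \<Sum>\<^sub>\<infinity>y. influence c x y / ennreal (\<rho> (dist x y))) < \<infinity>"

definition cond_R4 :: "'s::metric_space itself \<Rightarrow> (real \<Rightarrow> real) \<Rightarrow> bool" where
  "cond_R4 _ \<rho> \<longleftrightarrow> (SUP x::'s. \<Sum>\<^sub>\<infinity>y::'s. ennreal (\<rho> (dist x y))) < \<infinity>"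

definition thickening :: "'s::metric_space set \<Rightarrow> real \<Rightarrow> 's set" where
  "thickening \<Lambda> h = {u. infdist u \<Lambda> \<le> h}"

section \<open>Markov semigroups\<close>

definition markov_semigroup ::
    "(real \<Rightarrow> ('s, 'q::topological_space) obs \<Rightarrow> ('s, 'q) obs) \<Rightarrow> bool" where
  "markov_semigroup S \<longleftrightarrow>
     (\<forall>t\<ge>0. linear (S t)) \<and>
     (\<forall>f. S 0 f = f) \<and>
     (\<forall>s\<ge>0. \<forall>t\<ge>0. \<forall>f. S (s + t) f = S s (S t f)) \<and>
     (\<forall>f. \<forall>t\<ge>0. ((\<lambda>s. S s f) \<longlongrightarrow> S t f) (at_right t)) \<and>
     (\<forall>t\<ge>0. S t (const_bcontfun 1) = const_bcontfun 1) \<and>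
     (\<forall>t\<ge>0. \<forall>f. (\<forall>\<eta>. 0 \<le> apply_bcontfun f \<eta>) \<longrightarrow> (\<forall>\<eta>. 0 \<le> apply_bcontfun (S t f) \<eta>))"

definition generator_graph ::
    "(real \<Rightarrow> ('s, 'q::topological_space) obs \<Rightarrow> ('s, 'q) obs) \<Rightarrow> (('s, 'q) obs \<times> ('s, 'q) obs) set" where
  "generator_graph S = {(f, g). ((\<lambda>t. (S t f - f) /\<^sub>R t) \<longlongrightarrow> g) (at_right 0)}"

text \<open>\<open>S\<close> is the Markov semigroup generated by \<open>generator c V\<close> with core \<open>smooth_obs\<close>: its
  infinitesimal generator is the closure of \<open>generator c V\<close> restricted to \<open>smooth_obs\<close>.\<close>

definition generates ::
    "('s, 'q::topological_space) rates \<Rightarrow> 's set \<Rightarrow> (real \<Rightarrow> ('s, 'q) obs \<Rightarrow> ('s, 'q) obs) \<Rightarrow> bool" where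
  "generates c V S \<longleftrightarrow> markov_semigroup S \<and>
     generator_graph S =
       closure {(f, g). f \<in> smooth_obs \<and> (\<forall>\<eta>. apply_bcontfun g \<eta> = generator c V f \<eta>)}"

section \<open>Measures\<close>

definition prob_measures :: "('s, 'q::topological_space) config measure set" where
  "prob_measures = {\<mu>. prob_space \<mu> \<and> sets \<mu> = sets borel}"

text \<open>\<open>law_after S t \<mu> \<nu>\<close> says that \<open>\<nu>\<close> is the law \<open>\<mu>S(t)\<close>, which is determined by
  its integrals of continuous functions.\<close>

definition law_after ::
    "(real \<Rightarrow> ('s, 'q::topological_space) obs \<Rightarrow> ('s, 'q) obs) \<Rightarrow> real \<Rightarrow>
      ('s, 'q) config measure \<Rightarrow> ('s, 'q) config measure \<Rightarrow> bool" where
  "law_after S t \<mu> \<nu> \<longleftrightarrow> \<nu> \<in> prob_measures \<and>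
     (\<forall>f. (\<integral>\<eta>. apply_bcontfun f \<eta> \<partial>\<nu>) = (\<integral>\<eta>. apply_bcontfun (S t f) \<eta> \<partial>\<mu>))"

definition stationary ::
    "(real \<Rightarrow> ('s, 'q::topological_space) obs \<Rightarrow> ('s, 'q) obs) \<Rightarrow> ('s, 'q) config measure \<Rightarrow> bool" where
  "stationary S \<nu> \<longleftrightarrow> (\<forall>t\<ge>0. law_after S t \<nu> \<nu>)"

definition weakly_converges ::
    "('i \<Rightarrow> ('s, 'q::topological_space) config measure) \<Rightarrow> ('s, 'q) config measure \<Rightarrow> 'i filter \<Rightarrow> bool" where
  "weakly_converges \<mu> \<nu> A \<longleftrightarrow>
     (\<forall>f :: ('s, 'q) obs. ((\<lambda>i. \<integral>\<eta>. apply_bcontfun f \<eta> \<partial>\<mu> i) \<longlongrightarrow> (\<integral>\<eta>. apply_bcontfun f \<eta> \<partial>\<nu>)) A)"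

end

theory Submission
  imports Defs
begin

text \<open>
  For smooth \<open>f\<close>, (L1) makes the series for the generator dominated by a summable series that
  does not depend on the volume, so that the restricted generators converge uniformly to the full
  one as the volume grows. By a Trotter-Kurtz argument \<open>S\<^sup>h(t)f\<close> converges to \<open>S(t)f\<close>
  in norm for each fixed \<open>t\<close>. Since relaxation from \<open>\<eta>\<close> is uniform in \<open>h\<close>, choosing first \<open>t\<close>
  and then \<open>h\<close> large shows that \<open>\<mu>\<^sup>h(f)\<close> is Cauchy for local \<open>f\<close>; Kolmogorov extension gives the
  weak limit \<open>\<mu>\<^sup>*\<close>. Finally \<open>\<mu>\<^sup>*(S(t)f) = lim \<mu>\<^sup>h(S(t)f) = lim \<mu>\<^sup>h(S\<^sup>h(t)f) = lim \<mu>\<^sup>h(f) = \<mu>\<^sup>*(f)\<close>.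
\<close>

section \<open>Convergence of contraction semigroups\<close>

text \<open>This is \<open>generator_graph\<close> on an arbitrary normed space. Treating a
  generator as a relation lets closures be taken in the product space, without a separate
  domain.\<close>

definition infinitesimal_graph :: "(real \<Rightarrow> 'a \<Rightarrow> 'a::real_normed_vector) \<Rightarrow> ('a \<times> 'a) set" where
  "infinitesimal_graph T = {(f, g). ((\<lambda>t. (T t f - f) /\<^sub>R t) \<longlongrightarrow> g) (at_right 0)}"

text \<open>Control of short times comes from the graph: \<open>displacement_bound_approx\<close>
  bounds the motion of any vector through a nearby element of the generator's domain.\<close>

locale contraction_semigroup =
  fixes T :: "real \<Rightarrow> 'a \<Rightarrow> 'a::real_normed_vector"
  assumes linear: "t \<ge> 0 \<Longrightarrow> linear (T t)"
    and zero: "T 0 f = f"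
    and add: "s \<ge> 0 \<Longrightarrow> t \<ge> 0 \<Longrightarrow> T (s + t) f = T s (T t f)"
    and contraction: "t \<ge> 0 \<Longrightarrow> norm (T t f) \<le> norm f"
begin

lemma diff: "t \<ge> 0 \<Longrightarrow> T t (f - g) = T t f - T t g"
  by (simp add: linear linear_diff)

lemma plus: "t \<ge> 0 \<Longrightarrow> T t (f + g) = T t f + T t g"
  by (simp add: linear linear_add)

lemma scale: "t \<ge> 0 \<Longrightarrow> T t (a *\<^sub>R f) = a *\<^sub>R T t f"
  by (simp add: linear linear_scale)

lemma contraction_diff: "t \<ge> 0 \<Longrightarrow> norm (T t f - T t g) \<le> norm (f - g)"
  by (metis contraction diff)

section \<open>First-order estimates in time for a single semigroup\<close>

text \<open>\<open>T t\<close> commutes with \<open>T s\<close>, hence with the difference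
  quotients, and as a bounded linear map it passes through their limit.\<close>

lemma infinitesimal_graph_invariant:
  assumes "(f, g) \<in> infinitesimal_graph T" "t \<ge> 0"
  shows "(T t f, T t g) \<in> infinitesimal_graph T"
proof -
  have bl: "bounded_linear (T t)"
    by (rule bounded_linear_intro[of _ 1])
       (use assms(2) in \<open>auto simp: contraction scale linear linear_add\<close>)
  have "((\<lambda>s. T t ((T s f - f) /\<^sub>R s)) \<longlongrightarrow> T t g) (at_right 0)"
    using assms(1) by (intro bounded_linear.tendsto[OF bl]) (simp add: infinitesimal_graph_def)
  moreover have "\<forall>\<^sub>F s in at_right 0. T t ((T s f - f) /\<^sub>R s) = (T s (T t f) - T t f) /\<^sub>R s"
    using eventually_at_right_less[of 0]
  proof eventually_elim
    case (elim s)
    then show ?case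
      using assms(2) add[of s t f] add[of t s f] by (simp add: scale diff add.commute)
  qed
  ultimately show ?thesis
    unfolding infinitesimal_graph_def by (simp cong: tendsto_cong)
qed

text \<open>In integral form, \<open>T s u - u - s *\<^sub>R g\<close> is the integral of
  \<open>T r g - g\<close> over r in [0, s]. A sum over small steps takes the place of this
  integral.\<close>

lemma increment_bound:
  assumes ug: "(u, g) \<in> infinitesimal_graph T" and s: "s \<ge> 0"
    and K: "\<And>r. 0 \<le> r \<Longrightarrow> r \<le> s \<Longrightarrow> norm (T r g - g) \<le> K"
  shows "norm (T s u - u - s *\<^sub>R g) \<le> s * K"
proof (cases "s = 0")
  case True
  then show ?thesis by (simp add: zero)
next
  case False
  with s have s0: "s > 0" by simp
  show ?thesis
  proof (rule field_le_epsilon)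
    \<comment> \<open>A derivative error of \<open>e / s\<close> per unit of time adds up to
      \<open>e\<close> over the whole interval.\<close>
    fix e :: real assume e: "e > 0"
    then have "e / s > 0" using s0 by simp
    then have "\<forall>\<^sub>F t in at_right 0. dist ((T t u - u) /\<^sub>R t) g < e / s"
      using ug by (auto simp: infinitesimal_graph_def dest: tendstoD)
    then obtain d where d: "d > 0"
      "\<And>t. 0 < t \<Longrightarrow> t < d \<Longrightarrow> dist ((T t u - u) /\<^sub>R t) g < e / s"
      unfolding eventually_at_right_field by auto
    \<comment> \<open>With this many steps each has length below \<open>d\<close>, where the
      difference quotient is already within \<open>e / s\<close> of \<open>g\<close>.\<close>
    obtain n :: nat where n: "s / d < real n" using reals_Archimedean2 by blast
    then have n0: "n > 0" using s0 d(1) by (metis divide_pos_pos less_trans of_nat_0_less_iff)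
    define \<delta> where "\<delta> = s / n"
    have \<delta>: "\<delta> > 0" "\<delta> < d" and n\<delta>: "n * \<delta> = s"
      using n n0 s0 d(1) by (auto simp: \<delta>_def field_simps)
    have small: "norm (T \<delta> u - u - \<delta> *\<^sub>R g) \<le> \<delta> * (e / s)"
    proof -
      have "T \<delta> u - u - \<delta> *\<^sub>R g = \<delta> *\<^sub>R ((T \<delta> u - u) /\<^sub>R \<delta> - g)"
        using \<delta> by (simp add: algebra_simps)
      then have "norm (T \<delta> u - u - \<delta> *\<^sub>R g) = \<delta> * dist ((T \<delta> u - u) /\<^sub>R \<delta>) g"
        using \<delta> by (simp add: dist_norm)
      also have "\<dots> \<le> \<delta> * (e / s)"
        using d(2)[OF \<delta>] \<delta> by (intro mult_left_mono) auto
      finally show ?thesis .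
    qed
    have "norm (T (k * \<delta>) u - u - (k * \<delta>) *\<^sub>R g) \<le> k * \<delta> * (K + e / s)" if "k \<le> n" for k :: nat
      using that
    proof (induction k)
      case 0
      then show ?case by (simp add: zero)
    next
      case (Suc k)
      have k0: "0 \<le> k * \<delta>" using \<delta> by simp
      have "k * \<delta> \<le> n * \<delta>" using Suc.prems \<delta> by (intro mult_right_mono) auto
      then have ks: "k * \<delta> \<le> s" using n\<delta> by simp
      have "T (Suc k * \<delta>) u = T (k * \<delta>) (T \<delta> u)"
        using add[of "k * \<delta>" \<delta> u] k0 \<delta> by (simp add: algebra_simps)
      \<comment> \<open>The new step adds its own derivative error, carried along by the contraction
        \<open>T (k * \<delta>)\<close>, and the drift of \<open>g\<close> up to time
        \<open>k * \<delta>\<close>, which \<open>K\<close> bounds.\<close>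
      then have "T (Suc k * \<delta>) u - u - (Suc k * \<delta>) *\<^sub>R g =
        (T (k * \<delta>) u - u - (k * \<delta>) *\<^sub>R g) + T (k * \<delta>) (T \<delta> u - u - \<delta> *\<^sub>R g)
          + \<delta> *\<^sub>R (T (k * \<delta>) g - g)"
        using k0 by (simp add: diff plus scale algebra_simps)
      also have "norm \<dots> \<le> k * \<delta> * (K + e / s) + \<delta> * (e / s) + \<delta> * K"
        using Suc contraction[OF k0, of "T \<delta> u - u - \<delta> *\<^sub>R g"] small K[OF k0 ks] \<delta>
        by (intro norm_triangle_le add_mono) (auto intro: mult_left_mono)
      also have "\<dots> = Suc k * \<delta> * (K + e / s)"
        by (simp add: algebra_simps)
      finally show ?case .
    qed
    from this[of n] have "norm (T s u - u - s *\<^sub>R g) \<le> s * (K + e / s)"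
      by (simp add: n\<delta>)
    also have "\<dots> = s * K + e"
      using s0 by (simp add: field_simps)
    finally show "norm (T s u - u - s *\<^sub>R g) \<le> s * K + e" .
  qed
qed

text \<open>The factor 3 is 2 from the crude bound on \<open>norm (T r g - g)\<close> plus 1 from
  the linear term \<open>s *\<^sub>R g\<close>.\<close>

lemma displacement_bound:
  assumes "(u, g) \<in> infinitesimal_graph T" "s \<ge> 0"
  shows "norm (T s u - u) \<le> 3 * s * norm g"
proof -
  have "norm (T r g - g) \<le> 2 * norm g" if "0 \<le> r" for r
    using contraction[OF that, of g] norm_triangle_ineq4[of "T r g" g] by linarith
  then have "norm (T s u - u - s *\<^sub>R g) \<le> s * (2 * norm g)"
    by (intro increment_bound assms) auto
  moreover have "norm (T s u - u) \<le> norm (T s u - u - s *\<^sub>R g) + norm (s *\<^sub>R g)"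
    by (metis diff_add_cancel norm_triangle_ineq)
  ultimately show ?thesis using assms(2) by simp
qed

text \<open>The image of a generator need not lie in its domain. A domain element \<open>p\<close>
  close to \<open>g\<close> still keeps the displacement of \<open>g\<close> small, as the remainder
  in \<open>increment_bound\<close> requires.\<close>

lemma displacement_bound_approx:
  assumes "(p, r) \<in> infinitesimal_graph T" "s \<ge> 0"
  shows "norm (T s g - g) \<le> 2 * norm (g - p) + 3 * s * norm r"
proof -
  have "T s g - g = (T s g - T s p) + (T s p - p) - (g - p)" by simp
  also have "norm \<dots> \<le> norm (T s g - T s p) + norm (T s p - p) + norm (g - p)"
    by (meson norm_triangle_ineq norm_triangle_ineq4 order_trans add_right_mono)
  also have "\<dots> \<le> 2 * norm (g - p) + 3 * s * norm r"
    using contraction_diff[OF assms(2), of g p] displacement_bound[OF assms] by linarith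
  finally show ?thesis .
qed

end

section \<open>Comparison of two contraction semigroups\<close>

text \<open>Writing a and b for one step of \<open>A\<close> and \<open>B\<close>, the difference
  b^n - a^n is the sum of b^(n-1-k) (b - a) a^k, and powers of b do not increase norms. The one-step
  errors are thus all evaluated along the orbit of \<open>A\<close>.\<close>

lemma telescoping_bound:
  fixes A B :: "real \<Rightarrow> 'a \<Rightarrow> 'a::real_normed_vector" and n :: nat and \<delta> :: real
  assumes "contraction_semigroup A" "contraction_semigroup B" "\<delta> \<ge> 0"
  shows "norm (B (n * \<delta>) f - A (n * \<delta>) f)
    \<le> (\<Sum>k<n. norm (B \<delta> (A (k * \<delta>) f) - A \<delta> (A (k * \<delta>) f)))"
proof -
  interpret A: contraction_semigroup A by fact
  interpret B: contraction_semigroup B by fact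
  show ?thesis
  proof (induction n)
    case 0
    then show ?case by (simp add: A.zero B.zero)
  next
    case (Suc n)
    have n0: "0 \<le> n * \<delta>" using assms(3) by simp
    have eq: "Suc n * \<delta> = \<delta> + n * \<delta>" by (simp add: algebra_simps)
    have "B (Suc n * \<delta>) f - A (Suc n * \<delta>) f =
       (B \<delta> (B (n * \<delta>) f) - B \<delta> (A (n * \<delta>) f)) + (B \<delta> (A (n * \<delta>) f) - A \<delta> (A (n * \<delta>) f))"
      unfolding eq using n0 assms(3) by (simp add: A.add B.add)
    also have "norm \<dots> \<le> norm (B (n * \<delta>) f - A (n * \<delta>) f)
        + norm (B \<delta> (A (n * \<delta>) f) - A \<delta> (A (n * \<delta>) f))"
      by (intro norm_triangle_le add_right_mono B.contraction_diff assms)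
    also have "\<dots> \<le> (\<Sum>k<Suc n. norm (B \<delta> (A (k * \<delta>) f) - A \<delta> (A (k * \<delta>) f)))"
      using Suc by simp
    finally show ?case .
  qed
qed

text \<open>Both semigroups are expanded to first order in time. Since \<open>w\<close> is only
  known to lie in the domain of \<open>A\<close>, \<open>B\<close> is expanded at the nearby
  \<open>u\<close>; the pair \<open>(u', v')\<close> controls the remainder for \<open>B\<close> as
  \<open>(p, r)\<close> does for \<open>A\<close>. The five error terms give 13 = 1 + 7 + 1 + 1 +
  3.\<close>

lemma short_time_difference:
  fixes A B :: "real \<Rightarrow> 'a \<Rightarrow> 'a::real_normed_vector"
  assumes "contraction_semigroup A" "contraction_semigroup B"
    and wg: "(w, g) \<in> infinitesimal_graph A" and pr: "(p, r) \<in> infinitesimal_graph A"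
    and uv: "(u, v) \<in> infinitesimal_graph B" and uv': "(u', v') \<in> infinitesimal_graph B"
    and \<delta>: "0 \<le> \<delta>" "3 * \<delta> * (norm r + 1) \<le> \<epsilon>"
    and close: "norm (w - u) \<le> \<epsilon> * \<delta>" "norm (g - v) \<le> \<epsilon>" "norm (g - p) \<le> \<epsilon>"
      "norm (p - u') \<le> \<epsilon>" "norm (r - v') \<le> 1"
  shows "norm (B \<delta> w - A \<delta> w) \<le> 13 * \<epsilon> * \<delta>"
proof -
  interpret A: contraction_semigroup A by fact
  interpret B: contraction_semigroup B by fact
  \<comment> \<open>The margin 1 in \<open>norm r + 1\<close> leaves room for
    \<open>norm v'\<close>, so one smallness condition on \<open>\<delta>\<close>, stated through
    \<open>A\<close> alone, serves both semigroups.\<close>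
  have small: "3 * s * b \<le> \<epsilon>" if "0 \<le> s" "s \<le> \<delta>" "0 \<le> b" "b \<le> norm r + 1" for s b
    using mult_mono[OF that(2,4)] that \<delta> by simp
  have "norm (A s g - g) \<le> 3 * \<epsilon>" if "0 \<le> s" "s \<le> \<delta>" for s
    using A.displacement_bound_approx[OF pr that(1), of g] small[OF that, of "norm r"] close(3) by simp
  then have 1: "norm (A \<delta> w - w - \<delta> *\<^sub>R g) \<le> \<delta> * (3 * \<epsilon>)"
    by (intro A.increment_bound wg \<delta>)
  have v': "norm v' \<le> norm r + 1"
    using close(5) norm_triangle_ineq2[of v' r] by (simp add: norm_minus_commute)
  have vu': "norm (v - u') \<le> 3 * \<epsilon>"
  proof -
    have "v - u' = (g - p) + (p - u') - (g - v)" by simp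
    also have "norm \<dots> \<le> norm (g - p) + norm (p - u') + norm (g - v)"
      by (meson norm_triangle_ineq norm_triangle_ineq4 order_trans add_right_mono)
    finally show ?thesis using close by linarith
  qed
  \<comment> \<open>Twice the distance bound \<open>3 * \<epsilon>\<close> between \<open>v\<close>
    and \<open>u'\<close>, plus \<open>\<epsilon>\<close> for the time term, gives the factor
    7.\<close>
  have "norm (B s v - v) \<le> 7 * \<epsilon>" if "0 \<le> s" "s \<le> \<delta>" for s
    using B.displacement_bound_approx[OF uv' that(1), of v] small[OF that norm_ge_zero v'] vu' by linarith
  then have 2: "norm (B \<delta> u - u - \<delta> *\<^sub>R v) \<le> \<delta> * (7 * \<epsilon>)"
    by (intro B.increment_bound uv \<delta>)
  have 3: "norm (\<delta> *\<^sub>R (g - v)) \<le> \<delta> * \<epsilon>"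
    using \<delta> close by (simp add: mult_left_mono)
  have "B \<delta> w - A \<delta> w = (B \<delta> w - B \<delta> u) + (B \<delta> u - u - \<delta> *\<^sub>R v) - (w - u)
      - \<delta> *\<^sub>R (g - v) - (A \<delta> w - w - \<delta> *\<^sub>R g)"
    by (simp add: algebra_simps)
  also have "norm \<dots> \<le> norm (B \<delta> w - B \<delta> u) + norm (B \<delta> u - u - \<delta> *\<^sub>R v) + norm (w - u)
      + norm (\<delta> *\<^sub>R (g - v)) + norm (A \<delta> w - w - \<delta> *\<^sub>R g)"
    by (meson norm_triangle_ineq norm_triangle_ineq4 order_trans add_right_mono)
  also have "\<dots> \<le> \<epsilon> * \<delta> + \<delta> * (7 * \<epsilon>) + \<epsilon> * \<delta> + \<delta> * \<epsilon> + \<delta> * (3 * \<epsilon>)"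
    using B.contraction_diff[OF \<delta>(1), of w u] close(1) 1 2 3 by (intro add_mono) auto
  finally show ?thesis by (simp add: algebra_simps)
qed

text \<open>A Trotter-Kurtz theorem. Telescoping over small time steps replaces the resolvents of
  the usual argument, so that no completeness and no Banach-valued integrals are needed.\<close>

theorem contraction_semigroup_convergence:
  fixes A :: "real \<Rightarrow> 'a \<Rightarrow> 'a::real_normed_vector"
  assumes sgA: "contraction_semigroup A"
    and sgB: "\<forall>\<^sub>F h in \<F>. contraction_semigroup (B h)"
    and dense: "\<And>f e. e > 0 \<Longrightarrow> \<exists>(p, r)\<in>infinitesimal_graph A. norm (f - p) < e"
    and approx: "\<And>p e. p \<in> infinitesimal_graph A \<Longrightarrow> e > 0 \<Longrightarrow>
      \<forall>\<^sub>F h in \<F>. \<exists>q\<in>infinitesimal_graph (B h). dist p q < e"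
    and t: "t \<ge> 0"
  shows "((\<lambda>h. B h t f) \<longlongrightarrow> A t f) \<F>"
proof -
  interpret A: contraction_semigroup A by fact
  \<comment> \<open>The step length \<open>\<delta>\<close> is fixed before \<open>h\<close>: the
    graph of \<open>B h\<close> must come within \<open>\<epsilon> * \<delta>\<close> of
    \<open>w\<close> for the one-step error to carry a factor \<open>\<delta>\<close>.\<close>
  have step: "\<forall>\<^sub>F h in \<F>. norm (B h \<delta> w - A \<delta> w) \<le> 13 * \<epsilon> * \<delta>"
    if wg: "(w, g) \<in> infinitesimal_graph A" and pr: "(p, r) \<in> infinitesimal_graph A"
      and gp: "norm (g - p) \<le> \<epsilon>" and pos: "\<epsilon> > 0" "\<delta> > 0" and \<delta>: "3 * \<delta> * (norm r + 1) \<le> \<epsilon>"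
    for w g p r \<epsilon> \<delta>
  proof -
    have "min \<epsilon> (\<epsilon> * \<delta>) > 0" "min \<epsilon> 1 > 0" using pos by auto
    from sgB approx[OF wg this(1)] approx[OF pr this(2)]
    show ?thesis
    proof eventually_elim
      case (elim h)
      then obtain u v u' v' where uv: "(u, v) \<in> infinitesimal_graph (B h)"
          "dist (w, g) (u, v) < min \<epsilon> (\<epsilon> * \<delta>)"
        and uv': "(u', v') \<in> infinitesimal_graph (B h)" "dist (p, r) (u', v') < min \<epsilon> 1"
        by auto
      have "dist w u \<le> \<epsilon> * \<delta>" "dist g v \<le> \<epsilon>" "dist p u' \<le> \<epsilon>" "dist r v' \<le> 1"
        using uv(2) uv'(2) dist_fst_le[of "(w, g)" "(u, v)"] dist_snd_le[of "(w, g)" "(u, v)"]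
          dist_fst_le[of "(p, r)" "(u', v')"] dist_snd_le[of "(p, r)" "(u', v')"] by simp_all
      then show ?case
        using pos gp by (intro short_time_difference[OF sgA elim(1) wg pr uv(1) uv'(1) _ \<delta>])
          (simp_all add: dist_norm)
    qed
  qed
  have dom: "\<forall>\<^sub>F h in \<F>. norm (B h t f - A t f) \<le> \<epsilon>"
    if fg: "(f, g) \<in> infinitesimal_graph A" and \<epsilon>: "\<epsilon> > 0" for f g \<epsilon>
  proof -
    \<comment> \<open>The \<open>n\<close> steps will cost \<open>13 * \<epsilon>' * t\<close> in
      total; dividing by \<open>t + 1\<close> rather than \<open>t\<close> keeps this meaningful at
      \<open>t = 0\<close>.\<close>
    define \<epsilon>' where "\<epsilon>' = \<epsilon> / (13 * (t + 1))"
    have \<epsilon>': "\<epsilon>' > 0" "13 * \<epsilon>' * t \<le> \<epsilon>"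
      using \<epsilon> t by (auto simp: \<epsilon>'_def field_simps)
    obtain p r where pr: "(p, r) \<in> infinitesimal_graph A" "norm (g - p) < \<epsilon>'"
      using dense[OF \<epsilon>'(1), of g] by auto
    obtain n :: nat where n: "3 * (t + 1) * (norm r + 1) / \<epsilon>' < n"
      using reals_Archimedean2 by blast
    have "0 < 3 * (t + 1) * (norm r + 1) / \<epsilon>'"
      using t \<epsilon>' by (intro divide_pos_pos mult_pos_pos) (auto intro: add_nonneg_pos)
    then have n0: "n > 0" using n by (metis less_trans of_nat_0_less_iff)
    define \<delta> where "\<delta> = t / n"
    have n\<delta>: "n * \<delta> = t" using n0 by (simp add: \<delta>_def)
    show ?thesis
    proof (cases "t = 0")
      case True
      from sgB show ?thesis
        by eventually_elim (use True \<epsilon> in \<open>simp add: contraction_semigroup.zero A.zero\<close>)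
    next
      case False
      then have \<delta>: "\<delta> > 0" using t n0 by (simp add: \<delta>_def)
      have "3 * t * (norm r + 1) \<le> 3 * (t + 1) * (norm r + 1)"
        by (intro mult_right_mono) auto
      also have "\<dots> \<le> n * \<epsilon>'" using n \<epsilon>'(1) by (simp add: field_simps)
      finally have \<delta>r: "3 * \<delta> * (norm r + 1) \<le> \<epsilon>'"
        using n0 by (simp add: \<delta>_def field_simps)
      \<comment> \<open>Only finitely many orbit points occur, so the eventual statements combine.
        Invariance of the graph and contraction carry \<open>(p, r)\<close> along the orbit of
        \<open>A\<close>, hence the same \<open>\<delta>\<close> works for every
        \<open>k\<close>.\<close>
      have "\<forall>\<^sub>F h in \<F>. \<forall>k\<in>{..<n}.
          norm (B h \<delta> (A (k * \<delta>) f) - A \<delta> (A (k * \<delta>) f)) \<le> 13 * \<epsilon>' * \<delta>"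
      proof (intro eventually_ball_finite ballI step)
        fix k :: nat
        have k0: "0 \<le> k * \<delta>" using \<delta> by simp
        show "(A (k * \<delta>) f, A (k * \<delta>) g) \<in> infinitesimal_graph A"
          "(A (k * \<delta>) p, A (k * \<delta>) r) \<in> infinitesimal_graph A"
          by (intro A.infinitesimal_graph_invariant fg pr k0)+
        show "norm (A (k * \<delta>) g - A (k * \<delta>) p) \<le> \<epsilon>'"
          using A.contraction_diff[OF k0, of g p] pr(2) by simp
        have "3 * \<delta> * (norm (A (k * \<delta>) r) + 1) \<le> 3 * \<delta> * (norm r + 1)"
          using A.contraction[OF k0, of r] \<delta> by (intro mult_left_mono) auto
        then show "3 * \<delta> * (norm (A (k * \<delta>) r) + 1) \<le> \<epsilon>'"
          using \<delta>r by simp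
      qed (use \<delta> \<epsilon>' in auto)
      with sgB show ?thesis
      proof eventually_elim
        case (elim h)
        have "norm (B h (n * \<delta>) f - A (n * \<delta>) f)
            \<le> (\<Sum>k<n. norm (B h \<delta> (A (k * \<delta>) f) - A \<delta> (A (k * \<delta>) f)))"
          using \<delta> by (intro telescoping_bound[OF sgA elim(1)]) auto
        also have "\<dots> \<le> (\<Sum>k<n. 13 * \<epsilon>' * \<delta>)"
          using elim(2) by (intro sum_mono) auto
        also have "\<dots> = 13 * \<epsilon>' * (n * \<delta>)" by simp
        finally show ?case using \<epsilon>'(2) n\<delta> by simp
      qed
    qed
  qed
  show ?thesis
  proof (rule tendstoI)
    fix e :: real assume e: "e > 0"
    \<comment> \<open>Contractivity makes the replacement of \<open>f\<close> by \<open>p\<close>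
      cost less than \<open>e / 4\<close> for each semigroup, uniformly in \<open>h\<close>.\<close>
    then obtain p r where pr: "(p, r) \<in> infinitesimal_graph A" "norm (f - p) < e / 4"
      using dense[of "e / 4" f] by auto
    have "\<forall>\<^sub>F h in \<F>. norm (B h t p - A t p) \<le> e / 4"
      using e by (intro dom[OF pr(1)]) auto
    with sgB show "\<forall>\<^sub>F h in \<F>. dist (B h t f) (A t f) < e"
    proof eventually_elim
      case (elim h)
      have "B h t f - A t f = (B h t f - B h t p) + (B h t p - A t p) - (A t f - A t p)" by simp
      also have "norm \<dots> \<le> norm (B h t f - B h t p) + norm (B h t p - A t p) + norm (A t f - A t p)"
        by (meson norm_triangle_ineq norm_triangle_ineq4 order_trans add_right_mono)
      also have "\<dots> < e"
        using contraction_semigroup.contraction_diff[OF elim(1) t, of f p]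
          A.contraction_diff[OF t, of f p] elim(2) pr(2) e by linarith
      finally show ?case by (simp add: dist_norm)
    qed
  qed
qed

section \<open>Local observables\<close>

lemma open_config_contains_cylinder:
  fixes U :: "('s \<Rightarrow> 'q::topological_space) set"
  assumes "open U" "\<eta> \<in> U"
  obtains J where "finite J" "\<And>\<omega>. (\<And>i. i \<in> J \<Longrightarrow> \<omega> i = \<eta> i) \<Longrightarrow> \<omega> \<in> U"
proof -
  have "openin (product_topology (\<lambda>_::'s. euclidean :: 'q topology) UNIV) U"
    using assms(1) by (simp add: open_fun_def)
  from product_topology_open_contains_basis[OF this assms(2)]
  obtain X where X: "\<eta> \<in> Pi\<^sub>E UNIV X" "finite {i. X i \<noteq> UNIV}" "Pi\<^sub>E UNIV X \<subseteq> U"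
    by auto
  show thesis
  proof (rule that[OF X(2)])
    fix \<omega> assume eq: "\<And>i. i \<in> {i. X i \<noteq> UNIV} \<Longrightarrow> \<omega> i = \<eta> i"
    have "\<omega> i \<in> X i" for i
      using eq[of i] X(1) by (cases "X i = UNIV") (auto simp: PiE_iff)
    then show "\<omega> \<in> U" using X(3) by (auto simp: PiE_iff)
  qed
qed

lemma open_cylinder:
  fixes \<eta> :: "'s \<Rightarrow> 'q::discrete_topology"
  assumes "finite J"
  shows "open {\<omega>. \<forall>i\<in>J. \<omega> i = \<eta> i}"
  using product_topology_basis'[OF assms, of "\<lambda>i. {\<eta> i}" id]
  by (simp add: discrete_topology_class.open_discrete)

lemma apply_Bcontfun_local:
  fixes f :: "('s \<Rightarrow> 'q::{finite, discrete_topology}) \<Rightarrow> real"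
  assumes "local_fun f"
  shows "apply_bcontfun (Bcontfun f) = f"
  by (rule Bcontfun_inverse[OF local_fun_mem_bcontfun[OF assms]])

text \<open>Each configuration has a cylinder on which \<open>f\<close> varies by less than
  \<open>e / 4\<close> from its value there. By compactness finitely many of them suffice, and the
  union of their bases supports the approximation.\<close>

lemma local_obs_dense:
  fixes f :: "('s, 'q::{finite, discrete_topology}) obs"
  assumes "e > 0"
  obtains g :: "('s, 'q) obs" where "local_fun (apply_bcontfun g)" "norm (f - g) < e"
proof -
  have "\<exists>J. finite J \<and> (\<forall>\<omega>. (\<forall>i\<in>J. \<omega> i = \<eta> i) \<longrightarrow> dist (f \<omega>) (f \<eta>) < e / 4)" for \<eta>
  proof -
    have "open (f -` ball (f \<eta>) (e / 4))" "\<eta> \<in> f -` ball (f \<eta>) (e / 4)"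
      using assms by (auto intro: open_vimage continuous_on_apply_bcontfun)
    from open_config_contains_cylinder[OF this] show ?thesis
      by (metis (no_types, lifting) dist_commute mem_ball vimageE)
  qed
  then obtain J where J: "\<And>\<eta>. finite (J \<eta>)"
    "\<And>\<eta> \<omega>. (\<And>i. i \<in> J \<eta> \<Longrightarrow> \<omega> i = \<eta> i) \<Longrightarrow> dist (f \<omega>) (f \<eta>) < e / 4"
    by metis
  obtain D where D: "finite D" "UNIV \<subseteq> (\<Union>\<eta>\<in>D. {\<omega>. \<forall>i\<in>J \<eta>. \<omega> i = \<eta> i})"
    by (rule compactE_image[OF compact_configs, of UNIV "\<lambda>\<eta>. {\<omega>. \<forall>i\<in>J \<eta>. \<omega> i = \<eta> i}"])
       (auto intro: open_cylinder[OF J(1)])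
  define K where "K = (\<Union>\<eta>\<in>D. J \<eta>)"
  \<comment> \<open>The spins outside \<open>K\<close> are reset to those of a fixed arbitrary
    configuration. As \<open>K\<close> contains every base used, this does not leave the chosen
    cylinder.\<close>
  define g where "g \<omega> = f (override_on undefined \<omega> K)" for \<omega>
  have "finite K" using D J by (simp add: K_def)
  then have loc: "local_fun g"
    unfolding local_fun_def g_def
    by (intro exI[of _ K]) (auto intro!: arg_cong[where f = "apply_bcontfun f"] simp: override_on_def)
  have "norm (f - Bcontfun g) \<le> e / 2"
  proof (rule norm_bound)
    fix \<omega>
    obtain \<eta> where \<eta>: "\<eta> \<in> D" "\<forall>i\<in>J \<eta>. \<omega> i = \<eta> i" using D by blast
    have "dist (f \<omega>) (f \<eta>) < e / 4" using \<eta> by (intro J) auto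
    moreover have "dist (g \<omega>) (f \<eta>) < e / 4"
      unfolding g_def using \<eta> by (intro J) (auto simp: override_on_def K_def)
    ultimately have "dist (f \<omega>) (g \<omega>) \<le> e / 2"
      using dist_triangle2[of "f \<omega>" "g \<omega>" "f \<eta>"] by linarith
    then show "norm ((f - Bcontfun g) \<omega>) \<le> e / 2"
      by (simp add: minus_bcontfun.rep_eq apply_Bcontfun_local[OF loc] dist_real_def)
  qed
  then show thesis
    using assms loc by (intro that[of "Bcontfun g"]) (auto simp: apply_Bcontfun_local)
qed

section \<open>Oscillations and smooth observables\<close>

lemma oscillation_le: "oscillation x f \<le> ennreal (2 * norm f)"
  unfolding oscillation_def
proof (clarsimp intro!: SUP_least ennreal_leI)
  fix \<eta> \<xi>
  show "\<bar>f \<eta> - f \<xi>\<bar> \<le> 2 * norm f"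
    using norm_bounded[of f \<eta>] norm_bounded[of f \<xi>] by simp
qed

lemma oscillation_finite: "oscillation x f < \<infinity>"
  using oscillation_le[of x f] by (simp add: order_le_less_trans)

lemma oscillation_bound:
  assumes "\<And>y. y \<noteq> x \<Longrightarrow> \<eta> y = \<xi> y"
  shows "\<bar>apply_bcontfun f \<eta> - f \<xi>\<bar> \<le> enn2real (oscillation x f)"
proof -
  have "ennreal \<bar>f \<eta> - f \<xi>\<bar> \<le> oscillation x f"
    unfolding oscillation_def using assms by (intro SUP_upper2[of "(\<eta>, \<xi>)"]) auto
  then show ?thesis
    using enn2real_mono[of "ennreal \<bar>f \<eta> - f \<xi>\<bar>" "oscillation x f"] oscillation_finite[of x f] by simp
qed

text \<open>The sites of \<open>\<Delta>\<close> are changed one at a time, each at the cost of one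
  oscillation.\<close>

lemma override_on_bound:
  assumes "finite \<Delta>"
  shows "\<bar>apply_bcontfun f (override_on \<eta> \<xi> \<Delta>) - f \<eta>\<bar> \<le> (\<Sum>x\<in>\<Delta>. enn2real (oscillation x f))"
  using assms
proof (induction \<Delta>)
  case (insert x \<Delta>)
  have "\<bar>f (override_on \<eta> \<xi> (insert x \<Delta>)) - f (override_on \<eta> \<xi> \<Delta>)\<bar>
      \<le> enn2real (oscillation x f)"
    by (intro oscillation_bound) (auto simp: override_on_def)
  then show ?case using insert by simp
qed simp

lemma local_obs_smooth:
  fixes f :: "('s, 'q::topological_space) obs"
  assumes "local_fun (apply_bcontfun f)"
  shows "f \<in> smooth_obs"
proof -
  obtain J where J: "finite J" "\<And>\<eta> \<xi>. (\<forall>x\<in>J. \<eta> x = \<xi> x) \<Longrightarrow> f \<eta> = f \<xi>"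
    using assms unfolding local_fun_def by blast
  have "oscillation x f = 0" if "x \<notin> J" for x
  proof -
    have "f \<eta> = f \<xi>" if "\<forall>y. y \<noteq> x \<longrightarrow> \<eta> y = \<xi> y" for \<eta> \<xi>
      using that \<open>x \<notin> J\<close> by (intro J(2)) metis
    then show ?thesis
      unfolding oscillation_def by (intro antisym SUP_least) auto
  qed
  then have "(\<Sum>\<^sub>\<infinity>x. oscillation x f) = (\<Sum>\<^sub>\<infinity>x\<in>J. oscillation x f)"
    by (intro infsum_cong_neutral) auto
  also have "\<dots> = (\<Sum>x\<in>J. oscillation x f)"
    using J(1) by simp
  also have "\<dots> < \<infinity>"
    using J(1) oscillation_finite[of _ f] by simp
  finally show ?thesis by (simp add: smooth_obs_def)
qed

text \<open>Positivity is applied to the constant \<open>norm f\<close> minus \<open>f\<close> and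
  minus \<open>- f\<close>; since constants are preserved, this bounds \<open>S t f\<close> from
  both sides.\<close>

lemma markov_semigroup_contraction:
  fixes S :: "real \<Rightarrow> ('s, 'q::topological_space) obs \<Rightarrow> ('s, 'q) obs"
  assumes "markov_semigroup S"
  shows "contraction_semigroup S"
proof
  fix t :: real and f :: "('s, 'q) obs" assume t: "t \<ge> 0"
  have lin: "linear (S t)" and one: "S t (const_bcontfun 1) = const_bcontfun 1"
    and pos: "\<And>f. (\<And>\<eta>. 0 \<le> apply_bcontfun f \<eta>) \<Longrightarrow> (\<And>\<eta>. 0 \<le> apply_bcontfun (S t f) \<eta>)"
    using assms t unfolding markov_semigroup_def by blast+
  have bd: "apply_bcontfun (S t g) \<eta> \<le> norm f" if "\<And>\<eta>. apply_bcontfun g \<eta> \<le> norm f" for g \<eta>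
  proof -
    have "0 \<le> apply_bcontfun (S t (norm f *\<^sub>R const_bcontfun 1 - g)) \<eta>"
      using that by (intro pos) (simp add: minus_bcontfun.rep_eq scaleR_bcontfun.rep_eq const_bcontfun.rep_eq)
    then show ?thesis
      by (simp add: linear_diff[OF lin] linear_scale[OF lin] one
          minus_bcontfun.rep_eq scaleR_bcontfun.rep_eq const_bcontfun.rep_eq)
  qed
  show "norm (S t f) \<le> norm f"
  proof (rule norm_bound)
    fix \<eta>
    have "apply_bcontfun f \<eta> \<le> norm f" "apply_bcontfun (- f) \<eta> \<le> norm f" for \<eta>
      using norm_bounded[of f \<eta>] by (auto simp: uminus_bcontfun.rep_eq)
    then have "apply_bcontfun (S t f) \<eta> \<le> norm f" "apply_bcontfun (S t (- f)) \<eta> \<le> norm f"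
      by (blast intro: bd)+
    then show "norm (apply_bcontfun (S t f) \<eta>) \<le> norm f"
      by (simp add: linear_neg[OF lin] uminus_bcontfun.rep_eq)
  qed
next
  fix t :: real and f g :: "('s, 'q) obs" and r :: real assume "t \<ge> 0"
  then have lin: "linear (S t)" using assms by (simp add: markov_semigroup_def)
  show "S t (f + g) = S t f + S t g" by (rule linear_add[OF lin])
  show "S t (r *\<^sub>R f) = r *\<^sub>R S t f" by (rule linear_scale[OF lin])
next
  have *: "\<forall>f. S 0 f = f" "\<forall>s\<ge>0. \<forall>t\<ge>0. \<forall>f. S (s + t) f = S s (S t f)"
    using assms unfolding markov_semigroup_def by simp_all
  show "S 0 f = f" for f by (rule *(1)[rule_format])
  show "S (s + t) f = S s (S t f)" if "s \<ge> 0" "t \<ge> 0" for s t f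
    by (rule *(2)[rule_format, OF that])
qed

section \<open>Convergence of the generators\<close>

text \<open>An upper bound for the term of index \<open>\<Delta>\<close> in the series for \<open>generator c V f\<close>.\<close>

definition update_weight ::
    "('s, 'q::topological_space) rates \<Rightarrow> ('s, 'q) obs \<Rightarrow> 's set \<Rightarrow> real" where
  "update_weight c f \<Delta> =
     (\<Sum>\<xi>\<in>local_configs \<Delta>. norm (c \<Delta> \<xi>)) * (\<Sum>x\<in>\<Delta>. enn2real (oscillation x f))"

lemma update_weight_nonneg: "0 \<le> update_weight c f \<Delta>"
  by (simp add: update_weight_def sum_nonneg)

lemma generator_term_bound:
  fixes c :: "('s, 'q::topological_space) rates" and f :: "('s, 'q) obs"
  assumes "finite \<Delta>"
  shows "\<bar>\<Sum>\<xi>\<in>local_configs \<Delta>. apply_bcontfun (c \<Delta> \<xi>) \<eta> * (f (override_on \<eta> \<xi> \<Delta>) - f \<eta>)\<bar>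
    \<le> update_weight c f \<Delta>"
proof -
  have "\<bar>apply_bcontfun (c \<Delta> \<xi>) \<eta> * (f (override_on \<eta> \<xi> \<Delta>) - f \<eta>)\<bar>
      \<le> norm (c \<Delta> \<xi>) * (\<Sum>x\<in>\<Delta>. enn2real (oscillation x f))" for \<xi>
    using norm_bounded[of "c \<Delta> \<xi>" \<eta>] override_on_bound[OF assms, of f \<eta> \<xi>]
    unfolding abs_mult by (intro mult_mono) auto
  then show ?thesis
    unfolding update_weight_def sum_distrib_right by (intro order_trans[OF sum_abs] sum_mono)
qed

lemma sum_le_infsum_ennreal:
  fixes f :: "'a \<Rightarrow> ennreal"
  assumes "finite B" "B \<subseteq> A"
  shows "sum f B \<le> infsum f A"
proof -
  have "infsum f B \<le> infsum f A"
    using assms by (intro infsum_mono_neutral nonneg_summable_on_complete) auto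
  then show ?thesis using assms(1) by simp
qed

text \<open>Exchanging the sums over sets and sites gives each oscillation at x the total rate of
  the sets containing x as its factor. (L1) bounds these rates by \<open>K\<close>, and smoothness
  bounds the remaining sum by \<open>B\<close>.\<close>

lemma update_weight_summable:
  assumes "cond_L1 c" "f \<in> smooth_obs"
  shows "update_weight c f summable_on {\<Delta>. finite \<Delta>}"
proof (rule nonneg_bdd_above_summable_on)
  define R where "R \<Delta> = (\<Sum>\<xi>\<in>local_configs \<Delta>. norm (c \<Delta> \<xi>))" for \<Delta>
  have R0: "R \<Delta> \<ge> 0" for \<Delta> by (simp add: R_def sum_nonneg)
  define o' where "o' x = enn2real (oscillation x f)" for x
  \<comment> \<open>(L1) and smoothness make both extended values finite, so \<open>enn2real\<close>
    does not collapse them to its default 0.\<close>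
  define K where "K = enn2real (SUP x. \<Sum>\<^sub>\<infinity>\<Delta>\<in>{\<Delta>. finite \<Delta> \<and> x \<in> \<Delta>}. ennreal (R \<Delta>))"
  define B where "B = enn2real (\<Sum>\<^sub>\<infinity>x. oscillation x f)"
  have K: "(SUP x. \<Sum>\<^sub>\<infinity>\<Delta>\<in>{\<Delta>. finite \<Delta> \<and> x \<in> \<Delta>}. ennreal (R \<Delta>)) = ennreal K"
    using assms(1) by (simp add: K_def cond_L1_def R_def)
  have RK: "(\<Sum>\<Delta>\<in>\<F>. R \<Delta>) \<le> K" if "finite \<F>" "\<F> \<subseteq> {\<Delta>. finite \<Delta> \<and> x \<in> \<Delta>}" for \<F> x
  proof -
    have "ennreal (\<Sum>\<Delta>\<in>\<F>. R \<Delta>) = (\<Sum>\<Delta>\<in>\<F>. ennreal (R \<Delta>))"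
      using R0 by simp
    also have "\<dots> \<le> (\<Sum>\<^sub>\<infinity>\<Delta>\<in>{\<Delta>. finite \<Delta> \<and> x \<in> \<Delta>}. ennreal (R \<Delta>))"
      using that by (intro sum_le_infsum_ennreal) auto
    also have "\<dots> \<le> ennreal K"
      unfolding K[symmetric] by (rule SUP_upper) simp
    finally show ?thesis by (simp add: K_def)
  qed
  have oB: "(\<Sum>x\<in>X. o' x) \<le> B" if "finite X" for X
  proof -
    have "ennreal (\<Sum>x\<in>X. o' x) = (\<Sum>x\<in>X. oscillation x f)"
      using oscillation_finite[of _ f] by (subst sum_ennreal[symmetric]) (auto simp: o'_def)
    also have "\<dots> \<le> (\<Sum>\<^sub>\<infinity>x. oscillation x f)"
      using that by (intro sum_le_infsum_ennreal) auto
    also have "\<dots> = ennreal B"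
      using assms(2) by (simp add: B_def smooth_obs_def)
    finally show ?thesis by (simp add: B_def)
  qed
  have "(\<Sum>\<Delta>\<in>\<F>. update_weight c f \<Delta>) \<le> K * B" if "finite \<F>" "\<F> \<subseteq> {\<Delta>. finite \<Delta>}" for \<F>
  proof -
    have fin: "finite (\<Union>\<F>)" using that by auto
    have "(\<Sum>\<Delta>\<in>\<F>. update_weight c f \<Delta>) = (\<Sum>\<Delta>\<in>\<F>. \<Sum>x\<in>\<Delta>. R \<Delta> * o' x)"
      by (simp add: update_weight_def R_def o'_def sum_distrib_left)
    \<comment> \<open>Extending the inner sums by zero to one common finite set makes their range
      independent of \<open>\<Delta>\<close>, so that they can be swapped.\<close>
    also have "\<dots> = (\<Sum>\<Delta>\<in>\<F>. \<Sum>x\<in>\<Union>\<F>. if x \<in> \<Delta> then R \<Delta> * o' x else 0)"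
      using fin by (intro sum.cong refl sum.mono_neutral_cong_left) auto
    also have "\<dots> = (\<Sum>x\<in>\<Union>\<F>. \<Sum>\<Delta>\<in>\<F>. if x \<in> \<Delta> then R \<Delta> * o' x else 0)"
      by (rule sum.swap)
    also have "\<dots> = (\<Sum>x\<in>\<Union>\<F>. (\<Sum>\<Delta>\<in>{\<Delta>\<in>\<F>. x \<in> \<Delta>}. R \<Delta>) * o' x)"
      using that(1) by (simp add: sum_distrib_right sum.inter_filter[symmetric])
    also have "\<dots> \<le> (\<Sum>x\<in>\<Union>\<F>. K * o' x)"
      using that by (intro sum_mono mult_right_mono RK) (auto simp: o'_def)
    also have "\<dots> \<le> K * B"
      unfolding sum_distrib_left[symmetric] by (intro mult_left_mono oB fin) (simp add: K_def)
    finally show ?thesis .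
  qed
  then show "bdd_above (sum (update_weight c f) ` {F. F \<subseteq> {\<Delta>. finite \<Delta>} \<and> finite F})"
    by (intro bdd_aboveI[of _ "K * B"]) auto
qed (rule update_weight_nonneg)

lemma continuous_override_on:
  "continuous_on UNIV (\<lambda>\<eta>. override_on \<eta> \<xi> \<Delta> :: 's \<Rightarrow> 'q::topological_space)"
proof (rule continuous_on_coordinatewise_then_product)
  fix i
  show "continuous_on UNIV (\<lambda>\<eta> :: 's \<Rightarrow> 'q. override_on \<eta> \<xi> \<Delta> i)"
    by (cases "i \<in> \<Delta>") (simp_all add: continuous_on_product_coordinates)
qed

text \<open>By the Weierstrass test with majorant \<open>update_weight\<close>, the series is a
  uniform limit of continuous finite sums.\<close>

lemma generator_continuous:
  assumes "cond_L1 c" "f \<in> smooth_obs"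
  shows "continuous_on UNIV (generator c V f)"
proof -
  let ?g = "\<lambda>\<Delta> \<eta>. \<Sum>\<xi>\<in>local_configs \<Delta>. apply_bcontfun (c \<Delta> \<xi>) \<eta> * (f (override_on \<eta> \<xi> \<Delta>) - f \<eta>)"
  let ?V = "{\<Delta>. finite \<Delta> \<and> \<Delta> \<subseteq> V}"
  have ul: "uniform_limit UNIV (\<lambda>X \<eta>. \<Sum>\<Delta>\<in>X. ?g \<Delta> \<eta>) (\<lambda>\<eta>. \<Sum>\<^sub>\<infinity>\<Delta>\<in>?V. ?g \<Delta> \<eta>)
      (finite_subsets_at_top ?V)"
  proof (rule Weierstrass_m_test_general)
    show "update_weight c f summable_on ?V"
      using update_weight_summable[OF assms] by (rule summable_on_subset_banach) auto
  qed (use generator_term_bound in auto)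
  have "continuous_on UNIV (\<lambda>\<eta>. f (override_on \<eta> \<xi> \<Delta>))" for \<xi> \<Delta>
    by (rule continuous_on_compose2[OF continuous_on_apply_bcontfun[of UNIV] continuous_override_on]) simp
  then have "continuous_on UNIV (\<lambda>\<eta>. \<Sum>\<Delta>\<in>X. ?g \<Delta> \<eta>)" for X
    by (intro continuous_intros continuous_on_apply_bcontfun)
  then have "continuous_on UNIV (\<lambda>\<eta>. \<Sum>\<^sub>\<infinity>\<Delta>\<in>?V. ?g \<Delta> \<eta>)"
    by (intro uniform_limit_theorem[OF _ ul]) auto
  then show ?thesis
    unfolding generator_def .
qed

text \<open>A finite family of sets carries all but \<open>e\<close> of the summable majorant. If
  \<open>V\<close> contains their union, every discarded update lies outside that family, whatever
  the configuration.\<close>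

lemma generator_finite_range_approx:
  fixes c :: "('s, 'q::topological_space) rates"
  assumes "cond_L1 c" "f \<in> smooth_obs" "e > 0"
  obtains X where "finite X"
    "\<And>V \<eta>. X \<subseteq> V \<Longrightarrow> \<bar>generator c UNIV f \<eta> - generator c V f \<eta>\<bar> \<le> e"
proof -
  let ?A = "{\<Delta> :: 's set. finite \<Delta>}"
  let ?w = "update_weight c f"
  have sw: "?w summable_on ?A" by (rule update_weight_summable) fact+
  then have "((\<lambda>\<F>. sum ?w \<F>) \<longlongrightarrow> infsum ?w ?A) (finite_subsets_at_top ?A)"
    using has_sum_infsum has_sum_def by blast
  then have "\<forall>\<^sub>F \<F> in finite_subsets_at_top ?A. dist (sum ?w \<F>) (infsum ?w ?A) < e"
    using \<open>e > 0\<close> by (rule tendstoD)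
  then obtain \<F> where \<F>: "finite \<F>" "\<F> \<subseteq> ?A" "dist (sum ?w \<F>) (infsum ?w ?A) < e"
    unfolding eventually_finite_subsets_at_top by blast
  have tail: "infsum ?w (?A - \<F>) \<le> e"
    using \<F> infsum_Diff[OF sw summable_on_finite[OF \<F>(1)] \<F>(2)]
    by (simp add: dist_real_def)
  show thesis
  proof (rule that[of "\<Union>\<F>"])
    show "finite (\<Union>\<F>)" using \<F> by auto
    fix V \<eta> assume V: "\<Union>\<F> \<subseteq> V"
    define g where "g \<Delta> = (\<Sum>\<xi>\<in>local_configs \<Delta>. apply_bcontfun (c \<Delta> \<xi>) \<eta> * (f (override_on \<eta> \<xi> \<Delta>) - f \<eta>))" for \<Delta>
    have gw: "norm (g \<Delta>) \<le> ?w \<Delta>" if "\<Delta> \<in> ?A" for \<Delta>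
      using generator_term_bound[of \<Delta> c \<eta> f] that by (auto simp: g_def)
    let ?V = "{\<Delta>. finite \<Delta> \<and> \<Delta> \<subseteq> V}"
    have sg: "g summable_on ?A"
      by (rule Infinite_Sum.abs_summable_summable[OF Infinite_Sum.abs_summable_on_comparison_test'[OF sw gw]])
    have swV: "?w summable_on ?A - ?V"
      using sw by (rule summable_on_subset_banach) auto
    have "generator c UNIV f \<eta> - generator c V f \<eta> = infsum g ?A - infsum g ?V"
      by (simp add: generator_def g_def[abs_def])
    also have "\<dots> = infsum g (?A - ?V)"
      using sg by (intro infsum_Diff[symmetric] summable_on_subset_banach[OF sg]) auto
    also have "norm \<dots> \<le> infsum ?w (?A - ?V)"
      using gw by (intro norm_infsum_le[OF has_sum_infsum has_sum_infsum[OF swV]]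
        summable_on_subset_banach[OF sg]) auto
    also have "\<dots> \<le> infsum ?w (?A - \<F>)"
      using V by (intro infsum_mono2 swV summable_on_subset_banach[OF sw] update_weight_nonneg) auto
    also have "\<dots> \<le> e" by (rule tail)
    finally show "\<bar>generator c UNIV f \<eta> - generator c V f \<eta>\<bar> \<le> e" by simp
  qed
qed

section \<open>Convergence of the restricted semigroups\<close>

lemma generates_graph:
  assumes "generates c V S"
  shows "infinitesimal_graph S =
    closure {(f, g). f \<in> smooth_obs \<and> (\<forall>\<eta>. apply_bcontfun g \<eta> = generator c V f \<eta>)}"
  using assms by (simp add: generates_def generator_graph_def infinitesimal_graph_def)

text \<open>\<open>Bcontfun\<close> is meaningful only on bounded continuous functions; continuity
  and compactness ensure this, so the coerced generator has the intended values.\<close>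

lemma generator_approx_in_graph:
  fixes c :: "('s, 'q::{finite, discrete_topology}) rates"
  assumes "cond_L1 c" "f \<in> smooth_obs" "generates c V S"
  shows "(f, Bcontfun (generator c V f)) \<in> infinitesimal_graph S"
    and "apply_bcontfun (Bcontfun (generator c V f)) = generator c V f"
proof -
  show eq: "apply_bcontfun (Bcontfun (generator c V f)) = generator c V f"
    by (intro Bcontfun_inverse continuous_mem_bcontfun generator_continuous assms)
  show "(f, Bcontfun (generator c V f)) \<in> infinitesimal_graph S"
    unfolding generates_graph[OF assms(3)]
    by (rule subsetD[OF closure_subset]) (simp add: eq assms(2))
qed

text \<open>All the generators share the core \<open>smooth_obs\<close>. A point of the limiting
  graph is near a core pair, and keeping its first component while restricting the generator gives a
  nearby point of the graph for \<open>V h\<close>. Density of the domain comes from the local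
  observables.\<close>

theorem restricted_semigroup_convergence:
  fixes c :: "('s, 'q::{finite, discrete_topology}) rates"
  assumes L1: "cond_L1 c" and S: "generates c UNIV S"
    and Sh: "\<forall>\<^sub>F h in \<F>. generates c (V h) (Sh h)"
    and V: "\<And>x. \<forall>\<^sub>F h in \<F>. x \<in> V h"
    and t: "t \<ge> 0"
  shows "((\<lambda>h. Sh h t f) \<longlongrightarrow> S t f) \<F>"
proof (rule contraction_semigroup_convergence[where A = S and B = Sh, OF _ _ _ _ t])
  show "contraction_semigroup S"
    using S by (simp add: generates_def markov_semigroup_contraction)
  show "\<forall>\<^sub>F h in \<F>. contraction_semigroup (Sh h)"
    using Sh by eventually_elim (simp add: generates_def markov_semigroup_contraction)
next
  fix f :: "('s, 'q) obs" and e :: real assume "e > 0"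
  then obtain g :: "('s, 'q) obs" where "local_fun (apply_bcontfun g)" "norm (f - g) < e"
    by (rule local_obs_dense)
  then show "\<exists>(p, r)\<in>infinitesimal_graph S. norm (f - p) < e"
    using generator_approx_in_graph(1)[OF L1 local_obs_smooth S] by blast
next
  fix p :: "('s, 'q) obs \<times> ('s, 'q) obs" and e :: real
  assume p: "p \<in> infinitesimal_graph S" and e: "e > 0"
  have "p \<in> closure {(f, g). f \<in> smooth_obs \<and> (\<forall>\<eta>. apply_bcontfun g \<eta> = generator c UNIV f \<eta>)}"
    using p unfolding generates_graph[OF S] .
  moreover have "e / 2 > 0" using e by simp
  ultimately obtain f g where fg: "f \<in> smooth_obs" "\<And>\<eta>. apply_bcontfun g \<eta> = generator c UNIV f \<eta>"
    "dist (f, g) p < e / 2"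
    unfolding closure_approachable by fast
  obtain X where X: "finite X"
    "\<And>V \<eta>. X \<subseteq> V \<Longrightarrow> \<bar>generator c UNIV f \<eta> - generator c V f \<eta>\<bar> \<le> e / 2"
    using generator_finite_range_approx[OF L1 fg(1) \<open>e / 2 > 0\<close>] by blast
  have "\<forall>\<^sub>F h in \<F>. \<forall>x\<in>X. x \<in> V h"
    using X(1) V by (intro eventually_ball_finite) auto
  with Sh show "\<forall>\<^sub>F h in \<F>. \<exists>q\<in>infinitesimal_graph (Sh h). dist p q < e"
  proof eventually_elim
    case (elim h)
    let ?g = "Bcontfun (generator c (V h) f)"
    note gr = generator_approx_in_graph[OF L1 fg(1) elim(1)]
    have "norm (g - ?g) \<le> e / 2"
      using X(2)[of "V h"] elim(2)
      by (intro norm_bound) (auto simp: minus_bcontfun.rep_eq gr(2) fg(2))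
    then have "dist (f, g) (f, ?g) \<le> e / 2"
      by (simp add: dist_Pair_Pair dist_norm)
    then have "dist p (f, ?g) < e"
      using fg(3) dist_triangle3[of p "(f, ?g)" "(f, g)"] by linarith
    with gr(1) show ?case by blast
  qed
qed

section \<open>Limits of probability measures on configurations\<close>

text \<open>These are the cylinder sets, encoded by invariance so that Boolean operations only
  require the union of the supports.\<close>

definition local_sets :: "('s \<Rightarrow> 'q) set set" where
  "local_sets = {A. \<exists>J. finite J \<and> (\<forall>\<eta> \<xi>. (\<forall>x\<in>J. \<eta> x = \<xi> x) \<longrightarrow> (\<eta> \<in> A \<longleftrightarrow> \<xi> \<in> A))}"

lemma local_setsI:
  assumes "finite J" "\<And>\<eta> \<xi>. (\<And>x. x \<in> J \<Longrightarrow> \<eta> x = \<xi> x) \<Longrightarrow> \<eta> \<in> A \<Longrightarrow> \<xi> \<in> A"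
  shows "A \<in> local_sets"
proof -
  have "\<eta> \<in> A \<longleftrightarrow> \<xi> \<in> A" if "\<forall>x\<in>J. \<eta> x = \<xi> x" for \<eta> \<xi>
    using assms(2)[of \<eta> \<xi>] assms(2)[of \<xi> \<eta>] that by auto
  with assms(1) show ?thesis unfolding local_sets_def by blast
qed

lemma local_fun_indicator:
  assumes "A \<in> local_sets"
  shows "local_fun (indicat_real A)"
proof -
  obtain J where "finite J" "\<And>\<eta> \<xi>. (\<forall>x\<in>J. \<eta> x = \<xi> x) \<Longrightarrow> (\<eta> \<in> A \<longleftrightarrow> \<xi> \<in> A)"
    using assms unfolding local_sets_def by blast
  then show ?thesis
    unfolding local_fun_def by (intro exI[of _ J]) (simp add: indicator_def, blast)
qed

lemma vimage_local_sets:
  assumes "local_fun f"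
  shows "f -` B \<in> local_sets"
proof -
  obtain J where J: "finite J" "\<And>\<eta> \<xi>. (\<forall>x\<in>J. \<eta> x = \<xi> x) \<Longrightarrow> f \<eta> = f \<xi>"
    using assms unfolding local_fun_def by blast
  show ?thesis
  proof (rule local_setsI[OF J(1)])
    show "\<xi> \<in> f -` B" if "\<And>x. x \<in> J \<Longrightarrow> \<eta> x = \<xi> x" "\<eta> \<in> f -` B" for \<eta> \<xi>
      using J(2)[of \<eta> \<xi>] that by simp
  qed
qed

lemma algebra_local_sets: "algebra UNIV (local_sets :: ('s \<Rightarrow> 'q) set set)"
proof (rule algebra_iff_Un[THEN iffD2], intro conjI ballI)
  show "{} \<in> (local_sets :: ('s \<Rightarrow> 'q) set set)"
    by (rule local_setsI[of "{}"]) auto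
next
  fix A :: "('s \<Rightarrow> 'q) set" assume "A \<in> local_sets"
  then obtain J where "finite J" "\<And>\<eta> \<xi>. (\<forall>x\<in>J. \<eta> x = \<xi> x) \<Longrightarrow> (\<eta> \<in> A \<longleftrightarrow> \<xi> \<in> A)"
    unfolding local_sets_def by blast
  then show "UNIV - A \<in> local_sets"
    by (intro local_setsI[of J]) blast+
next
  fix A B :: "('s \<Rightarrow> 'q) set" assume "A \<in> local_sets" "B \<in> local_sets"
  then obtain J K where J: "finite J" "\<And>\<eta> \<xi>. (\<forall>x\<in>J. \<eta> x = \<xi> x) \<Longrightarrow> (\<eta> \<in> A \<longleftrightarrow> \<xi> \<in> A)"
    and K: "finite K" "\<And>\<eta> \<xi>. (\<forall>x\<in>K. \<eta> x = \<xi> x) \<Longrightarrow> (\<eta> \<in> B \<longleftrightarrow> \<xi> \<in> B)"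
    unfolding local_sets_def by blast
  show "A \<union> B \<in> local_sets"
  proof (rule local_setsI[of "J \<union> K"])
    show "\<xi> \<in> A \<union> B" if "\<And>x. x \<in> J \<union> K \<Longrightarrow> \<eta> x = \<xi> x" "\<eta> \<in> A \<union> B" for \<eta> \<xi>
      using J(2)[of \<eta> \<xi>] K(2)[of \<eta> \<xi>] that by auto
  qed (simp add: J K)
qed auto

text \<open>The indicator is local, hence continuous. Complements of local sets are local, so these
  sets are also closed.\<close>

lemma open_local_sets:
  fixes A :: "('s \<Rightarrow> 'q::{finite, discrete_topology}) set"
  assumes "A \<in> local_sets"
  shows "open A"
proof -
  have "continuous_on UNIV (indicat_real A)"
    using continuous_on_apply_bcontfun[of UNIV "Bcontfun (indicat_real A)"]
    by (simp add: apply_Bcontfun_local[OF local_fun_indicator[OF assms]])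
  then have "open (indicat_real A -` {0<..})"
    by (intro open_vimage) auto
  also have "indicat_real A -` {0<..} = A"
    by (auto simp: indicator_def)
  finally show ?thesis .
qed

text \<open>Countability of the sites enters here: it makes every open set a countable union of
  local sets.\<close>

lemma sigma_sets_local_sets:
  "sigma_sets UNIV (local_sets :: ('s::countable \<Rightarrow> 'q::{finite, discrete_topology}) set set) = sets borel"
proof (intro equalityI)
  show "sigma_sets UNIV (local_sets :: ('s \<Rightarrow> 'q) set set) \<subseteq> sets borel"
    using sets.sigma_sets_subset[of local_sets "borel :: ('s \<Rightarrow> 'q) measure"]
    by (simp add: open_local_sets subsetI)
  have "U \<in> sigma_sets UNIV local_sets" if "open U" for U :: "('s \<Rightarrow> 'q) set"
  proof -
    define J where "J n = {x :: 's. to_nat x < n}" for n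
    have J: "finite (J n)" for n
      by (rule finite_imageD[of to_nat]) (auto intro: finite_subset[of _ "{..<n}"] simp: J_def)
    \<comment> \<open>\<open>W n\<close> is the largest subset of \<open>U\<close> that depends only
      on the first \<open>n\<close> sites of the enumeration.\<close>
    define W where "W n = {\<eta>. \<forall>\<omega>. (\<forall>x\<in>J n. \<omega> x = \<eta> x) \<longrightarrow> \<omega> \<in> U}" for n
    have W: "W n \<in> local_sets" for n
      by (rule local_setsI[OF J[of n]]) (auto simp: W_def)
    have "U \<subseteq> (\<Union>n. W n)"
    proof
      fix \<eta> assume "\<eta> \<in> U"
      then obtain K where K: "finite K" "\<And>\<omega>. (\<And>i. i \<in> K \<Longrightarrow> \<omega> i = \<eta> i) \<Longrightarrow> \<omega> \<in> U"
        using open_config_contains_cylinder[OF \<open>open U\<close>] by metis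
      obtain n where "\<forall>k\<in>to_nat ` K. k < n"
        using finite_nat_set_iff_bounded K(1) by blast
      then have "\<eta> \<in> W n"
        using K(2) by (auto simp: W_def J_def)
      then show "\<eta> \<in> (\<Union>n. W n)" by blast
    qed
    moreover have "W n \<subseteq> U" for n by (auto simp: W_def)
    ultimately have "U = (\<Union>n. W n)" by blast
    then show ?thesis
      using W by (auto intro: sigma_sets.Union sigma_sets.Basic)
  qed
  then show "sets borel \<subseteq> sigma_sets UNIV (local_sets :: ('s \<Rightarrow> 'q) set set)"
    unfolding borel_def by (simp, intro sigma_sets_mono) auto
qed

section \<open>Integrals of observables and weak limits\<close>

lemma integrable_obs:
  fixes f :: "('s, 'q::topological_space) obs"
  assumes "\<nu> \<in> prob_measures"
  shows "integrable \<nu> (apply_bcontfun f)"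
proof -
  interpret prob_space \<nu> using assms by (simp add: prob_measures_def)
  have "apply_bcontfun f \<in> borel_measurable \<nu>"
    using assms borel_measurable_continuous_onI[OF continuous_on_apply_bcontfun[of UNIV f]]
    by (simp add: prob_measures_def cong: measurable_cong_sets)
  then show ?thesis
    by (intro integrable_const_bound[of "apply_bcontfun f" "norm f"] AE_I2 norm_bounded)
qed

lemma integral_obs_diff:
  fixes f g :: "('s, 'q::topological_space) obs"
  assumes "\<nu> \<in> prob_measures"
  shows "\<bar>(\<integral>\<eta>. apply_bcontfun f \<eta> \<partial>\<nu>) - (\<integral>\<eta>. apply_bcontfun g \<eta> \<partial>\<nu>)\<bar> \<le> norm (f - g)"
proof -
  interpret prob_space \<nu> using assms by (simp add: prob_measures_def)
  have "(\<integral>\<eta>. apply_bcontfun f \<eta> \<partial>\<nu>) - (\<integral>\<eta>. apply_bcontfun g \<eta> \<partial>\<nu>)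
      = (\<integral>\<eta>. apply_bcontfun (f - g) \<eta> \<partial>\<nu>)"
    by (simp add: minus_bcontfun.rep_eq integrable_obs assms)
  also have "norm \<dots> \<le> (\<integral>\<eta>. norm (apply_bcontfun (f - g) \<eta>) \<partial>\<nu>)"
    by (rule integral_norm_bound)
  also have "\<dots> \<le> (\<integral>\<eta>. norm (f - g) \<partial>\<nu>)"
    by (intro integral_mono integrable_norm integrable_obs integrable_const norm_bounded assms)
  also have "\<dots> = norm (f - g)" by (simp add: prob_space)
  finally show ?thesis by simp
qed

text \<open>A local function is determined by finitely many spins, each with finitely many values.
  Convergence of its integrals thus reduces to convergence of probabilities of local sets.\<close>

lemma integral_local_obs:
  fixes f :: "('s \<Rightarrow> 'q::{finite, discrete_topology}) \<Rightarrow> real"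
  assumes f: "local_fun f" and \<nu>: "\<nu> \<in> prob_measures"
  shows "finite (range f)" "(\<integral>\<eta>. f \<eta> \<partial>\<nu>) = (\<Sum>v\<in>range f. v * measure \<nu> (f -` {v}))"
proof -
  interpret prob_space \<nu> using \<nu> by (simp add: prob_measures_def)
  obtain J where J: "finite J" "\<And>\<eta> \<xi>. (\<forall>x\<in>J. \<eta> x = \<xi> x) \<Longrightarrow> f \<eta> = f \<xi>"
    using f unfolding local_fun_def by blast
  have "f \<eta> \<in> f ` (J \<rightarrow>\<^sub>E UNIV)" for \<eta>
    by (rule image_eqI[of _ _ "restrict \<eta> J"]) (auto intro!: J(2))
  then have "range f \<subseteq> f ` (J \<rightarrow>\<^sub>E UNIV)" by blast
  then show fin: "finite (range f)"
    by (rule finite_subset) (simp add: J(1) finite_PiE)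
  have sets: "f -` {v} \<in> sets \<nu>" for v
    using open_local_sets[OF vimage_local_sets[OF f]] \<nu> by (simp add: prob_measures_def)
  have "f \<eta> = (\<Sum>v\<in>range f. v * indicator (f -` {v}) \<eta>)" for \<eta>
  proof -
    have "(\<Sum>v\<in>range f. v * indicator (f -` {v}) \<eta>) = (\<Sum>v\<in>range f. if v = f \<eta> then v else 0)"
      by (intro sum.cong) (auto simp: indicator_def)
    then show ?thesis using fin by simp
  qed
  then have "(\<integral>\<eta>. f \<eta> \<partial>\<nu>) = (\<integral>\<eta>. (\<Sum>v\<in>range f. v * indicator (f -` {v}) \<eta>) \<partial>\<nu>)"
    by (rule Bochner_Integration.integral_cong[OF refl])
  also have "\<dots> = (\<Sum>v\<in>range f. \<integral>\<eta>. v * indicator (f -` {v}) \<eta> \<partial>\<nu>)"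
    by (intro Bochner_Integration.integral_sum integrable_mult_right integrable_real_indicator sets)
       (simp add: less_top[symmetric])
  also have "\<dots> = (\<Sum>v\<in>range f. v * measure \<nu> (f -` {v}))"
    using sets[THEN sets.sets_into_space] by (simp add: Int_absorb2)
  finally show "(\<integral>\<eta>. f \<eta> \<partial>\<nu>) = (\<Sum>v\<in>range f. v * measure \<nu> (f -` {v}))" .
qed

text \<open>Kolmogorov extension: by compactness, a finitely additive content on the local sets is
  automatically continuous at the empty set.\<close>

lemma limit_measure_exists:
  fixes \<mu> :: "'i \<Rightarrow> ('s::countable, 'q::{finite, discrete_topology}) config measure"
  assumes \<F>: "\<F> \<noteq> bot" and \<mu>: "\<forall>\<^sub>F h in \<F>. \<mu> h \<in> prob_measures"
    and conv: "\<And>A. A \<in> local_sets \<Longrightarrow> ((\<lambda>h. measure (\<mu> h) A) \<longlongrightarrow> m A) \<F>"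
  obtains \<nu> where "\<nu> \<in> prob_measures" "\<And>A. A \<in> local_sets \<Longrightarrow> measure \<nu> A = m A"
proof -
  interpret algebra UNIV "local_sets :: ('s \<Rightarrow> 'q) set set" by (rule algebra_local_sets)
  have m0: "m A \<ge> 0" if "A \<in> local_sets" for A
    by (rule tendsto_lowerbound[OF conv[OF that] _ \<F>]) simp
  have mempty: "m {} = 0"
    using tendsto_unique[OF \<F> conv[of "{}"]] by simp
  have "\<forall>\<^sub>F h in \<F>. measure (\<mu> h) UNIV = 1"
    using \<mu>
  proof eventually_elim
    case (elim h)
    then interpret prob_space "\<mu> h" by (simp add: prob_measures_def)
    have "space (\<mu> h) = UNIV"
      using elim sets_eq_imp_space_eq[of "\<mu> h" borel] by (simp add: prob_measures_def)
    then show ?case using prob_space by simp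
  qed
  then have m1: "m UNIV = 1"
    by (intro tendsto_unique[OF \<F> conv[of UNIV]] tendsto_eventually) simp_all
  \<comment> \<open>Finite additivity survives the limit; countable additivity has to be recovered
    from compactness.\<close>
  have madd: "m (A \<union> B) = m A + m B"
    if AB: "A \<in> local_sets" "B \<in> local_sets" "A \<inter> B = {}" for A B
  proof (rule tendsto_unique[OF \<F> conv])
    show "A \<union> B \<in> local_sets" using AB by blast
    have "\<forall>\<^sub>F h in \<F>. measure (\<mu> h) A + measure (\<mu> h) B = measure (\<mu> h) (A \<union> B)"
      using \<mu>
    proof eventually_elim
      case (elim h)
      then interpret prob_space "\<mu> h" by (simp add: prob_measures_def)
      have "A \<in> sets (\<mu> h)" "B \<in> sets (\<mu> h)"
        using elim AB by (auto simp: prob_measures_def open_local_sets)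
      then show ?case using AB(3) by (simp add: finite_measure_Union)
    qed
    with tendsto_add[OF conv[OF AB(1)] conv[OF AB(2)]]
    show "((\<lambda>h. measure (\<mu> h) (A \<union> B)) \<longlongrightarrow> m A + m B) \<F>"
      by (rule Lim_transform_eventually)
  qed
  have "\<exists>\<mu>'. (\<forall>A\<in>local_sets. \<mu>' A = ennreal (m A)) \<and>
      measure_space UNIV (sigma_sets UNIV (local_sets :: ('s \<Rightarrow> 'q) set set)) \<mu>'"
  proof (rule caratheodory_empty_continuous)
    show "positive local_sets (\<lambda>A. ennreal (m A))"
      by (simp add: positive_def mempty)
    show "additive local_sets (\<lambda>A. ennreal (m A))"
      by (simp add: additive_def madd m0)
    fix A :: "nat \<Rightarrow> ('s \<Rightarrow> 'q) set"
    assume A: "range A \<subseteq> local_sets" "decseq A" "(\<Inter>i. A i) = {}"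
    \<comment> \<open>The sets \<open>A n\<close> are closed, so their complements form an open
      cover with a finite subcover; the decreasing sequence is therefore empty from some index
      on.\<close>
    have "open (- A n)" for n
      using A(1) by (intro open_local_sets) (auto simp: Compl_eq_Diff_UNIV)
    moreover have "UNIV \<subseteq> (\<Union>n\<in>UNIV. - A n)" using A(3) by auto
    ultimately obtain D where D: "finite D" "UNIV \<subseteq> (\<Union>n\<in>D. - A n)"
      using compactE_image[OF compact_configs, of UNIV "\<lambda>n. - A n"] by metis
    \<comment> \<open>Inserting 0 makes the maximum well defined without a separate argument that
      \<open>D\<close> is nonempty.\<close>
    have "A n = {}" if "n \<ge> Max (insert 0 D)" for n
    proof -
      have "A n \<subseteq> A k" if "k \<in> D" for k
        using \<open>n \<ge> Max (insert 0 D)\<close> that D(1) by (intro decseqD[OF A(2)]) auto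
      then show ?thesis using D(2) by blast
    qed
    then have "\<forall>\<^sub>F n in sequentially. ennreal (m (A n)) = 0"
      by (intro eventually_sequentiallyI[of "Max (insert 0 D)"]) (simp add: mempty)
    then show "(\<lambda>i. ennreal (m (A i))) \<longlonglongrightarrow> 0"
      by (rule tendsto_eventually)
  qed auto
  then obtain \<mu>' where \<mu>': "\<And>A. A \<in> local_sets \<Longrightarrow> \<mu>' A = ennreal (m A)"
    "measure_space UNIV (sets (borel :: ('s \<Rightarrow> 'q) measure)) \<mu>'"
    unfolding sigma_sets_local_sets by blast
  define \<nu> where "\<nu> = measure_of UNIV (sets (borel :: ('s \<Rightarrow> 'q) measure)) \<mu>'"
  have sets: "sets \<nu> = sets borel" "space \<nu> = UNIV"
    using sets.sigma_sets_eq[of "borel :: ('s \<Rightarrow> 'q) measure"]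
    by (simp_all add: \<nu>_def sets_measure_of_conv space_measure_of_conv)
  have emeasure: "emeasure \<nu> A = ennreal (m A)" if "A \<in> local_sets" for A
    using \<mu>' that open_local_sets[OF that]
    by (simp add: \<nu>_def measure_space_def emeasure_measure_of_sigma)
  show thesis
  proof (rule that)
    show "\<nu> \<in> prob_measures"
      unfolding prob_measures_def using sets emeasure[of UNIV] m1 by (auto intro!: prob_spaceI)
    show "measure \<nu> A = m A" if "A \<in> local_sets" for A
      using emeasure[OF that] m0[OF that] by (simp add: measure_def)
  qed
qed

text \<open>Applied to indicators, the hypothesis yields limiting probabilities of local sets, which
  extend to a measure. Convergence then passes to local observables as finite combinations, and to
  all observables by density.\<close>

lemma weak_limit_exists:
  fixes \<mu> :: "'i \<Rightarrow> ('s::countable, 'q::{finite, discrete_topology}) config measure"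
  assumes \<F>: "\<F> \<noteq> bot" and \<mu>: "\<forall>\<^sub>F h in \<F>. \<mu> h \<in> prob_measures"
    and conv: "\<And>f :: ('s, 'q) obs. local_fun (apply_bcontfun f) \<Longrightarrow>
      \<exists>l. ((\<lambda>h. \<integral>\<eta>. apply_bcontfun f \<eta> \<partial>\<mu> h) \<longlongrightarrow> l) \<F>"
  obtains \<nu> where "\<nu> \<in> prob_measures" "weakly_converges \<mu> \<nu> \<F>"
proof -
  have "\<exists>l. ((\<lambda>h. measure (\<mu> h) A) \<longlongrightarrow> l) \<F>" if A: "A \<in> local_sets" for A :: "('s \<Rightarrow> 'q) set"
  proof -
    have ind: "apply_bcontfun (Bcontfun (indicat_real A)) = indicat_real A"
      by (intro apply_Bcontfun_local local_fun_indicator A)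
    then obtain l where l: "((\<lambda>h. \<integral>\<eta>. indicat_real A \<eta> \<partial>\<mu> h) \<longlongrightarrow> l) \<F>"
      using conv[of "Bcontfun (indicat_real A)"] local_fun_indicator[OF A] by auto
    have "\<forall>\<^sub>F h in \<F>. (\<integral>\<eta>. indicat_real A \<eta> \<partial>\<mu> h) = measure (\<mu> h) A"
      using \<mu>
    proof eventually_elim
      case (elim h)
      then show ?case
        using sets_eq_imp_space_eq[of "\<mu> h" borel] by (simp add: prob_measures_def)
    qed
    with l show ?thesis by (blast intro: Lim_transform_eventually)
  qed
  then obtain m where m: "\<And>A :: ('s \<Rightarrow> 'q) set. A \<in> local_sets \<Longrightarrow> ((\<lambda>h. measure (\<mu> h) A) \<longlongrightarrow> m A) \<F>"
    by metis
  obtain \<nu> where \<nu>: "\<nu> \<in> prob_measures" "\<And>A. A \<in> local_sets \<Longrightarrow> measure \<nu> A = m A"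
    using limit_measure_exists[OF \<F> \<mu> m] by blast
  have loc: "((\<lambda>h. \<integral>\<eta>. f \<eta> \<partial>\<mu> h) \<longlongrightarrow> (\<integral>\<eta>. f \<eta> \<partial>\<nu>)) \<F>" if f: "local_fun f" for f
  proof -
    have "((\<lambda>h. \<Sum>v\<in>range f. v * measure (\<mu> h) (f -` {v})) \<longlongrightarrow>
        (\<Sum>v\<in>range f. v * measure \<nu> (f -` {v}))) \<F>"
      using vimage_local_sets[OF f] by (intro tendsto_intros) (simp add: \<nu> m)
    moreover have "\<forall>\<^sub>F h in \<F>. (\<Sum>v\<in>range f. v * measure (\<mu> h) (f -` {v})) = (\<integral>\<eta>. f \<eta> \<partial>\<mu> h)"
      using \<mu> by eventually_elim (simp add: integral_local_obs[OF f])
    ultimately show ?thesis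
      unfolding integral_local_obs(2)[OF f \<nu>(1)] by (rule Lim_transform_eventually)
  qed
  have "weakly_converges \<mu> \<nu> \<F>"
    unfolding weakly_converges_def
  proof (intro allI tendstoI)
    fix f :: "('s, 'q) obs" and e :: real assume e: "e > 0"
    then have "e / 3 > 0" by simp
    then obtain g :: "('s, 'q) obs" where g: "local_fun (apply_bcontfun g)" "norm (f - g) < e / 3"
      by (rule local_obs_dense)
    have "\<forall>\<^sub>F h in \<F>. dist (\<integral>\<eta>. g \<eta> \<partial>\<mu> h) (\<integral>\<eta>. g \<eta> \<partial>\<nu>) < e / 3"
      using \<open>e / 3 > 0\<close> by (rule tendstoD[OF loc[OF g(1)]])
    with \<mu> show "\<forall>\<^sub>F h in \<F>. dist (\<integral>\<eta>. f \<eta> \<partial>\<mu> h) (\<integral>\<eta>. f \<eta> \<partial>\<nu>) < e"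
    proof eventually_elim
      case (elim h)
      then show ?case
        using integral_obs_diff[OF elim(1), of f g] integral_obs_diff[OF \<nu>(1), of f g] g(2)
        unfolding dist_real_def by linarith
    qed
  qed
  with \<nu>(1) show thesis by (rule that)
qed

section \<open>The infinite-volume limit\<close>

lemma eventually_in_thickening: "\<forall>\<^sub>F h in at_top. x \<in> thickening \<Lambda> h"
  using eventually_ge_at_top[of "infdist x \<Lambda>"] by (simp add: thickening_def)

theorem theorem2p2:
  fixes c :: "('s::{countable, metric_space}, 'q::{finite, discrete_topology}) rates"
    and \<rho> :: "real \<Rightarrow> real" and L :: real
    and \<Lambda> :: "'s set"
    and S :: "real \<Rightarrow> ('s, 'q) obs \<Rightarrow> ('s, 'q) obs"
    and Sh :: "real \<Rightarrow> real \<Rightarrow> ('s, 'q) obs \<Rightarrow> ('s, 'q) obs"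
    and \<eta> :: "('s, 'q) config"
    and F :: "real \<Rightarrow> real"
    and \<mu> :: "real \<Rightarrow> ('s, 'q) config measure"
    and C :: "('s, 'q) obs \<Rightarrow> real"
  assumes "infinite (UNIV :: 's set)"
    and "nonneg_rates c"
    and "\<And>r. r \<ge> 0 \<Longrightarrow> \<rho> r > 0" and "antimono_on {0..} \<rho>"
    and "L > 0"
    and "cond_L1 c" and "cond_R1 c L" and "cond_R2 TYPE('s) \<rho>"
    and "cond_R3 c \<rho>" and "cond_R4 TYPE('s) \<rho>"
    and "generates c UNIV S"
    and "finite \<Lambda>" and "\<Lambda> \<noteq> {}"
    and "\<And>h. h > 0 \<Longrightarrow> generates c (thickening \<Lambda> h) (Sh h)"
    and "antimono_on {0..} F" and "(F \<longlongrightarrow> 0) at_top"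
    and "\<And>h. h > 0 \<Longrightarrow> \<mu> h \<in> prob_measures"
    and "\<And>h. h > 0 \<Longrightarrow> stationary (Sh h) (\<mu> h)"
    and "\<And>h f t. h > 0 \<Longrightarrow> local_fun (apply_bcontfun f) \<Longrightarrow> t \<ge> 0 \<Longrightarrow>
           \<bar>Sh h t f \<eta> - (\<integral>\<omega>. f \<omega> \<partial>\<mu> h)\<bar> \<le> C f * F t"
  shows "\<exists>\<mu>'\<in>prob_measures. weakly_converges \<mu> \<mu>' at_top \<and> stationary S \<mu>'"
proof -
  note relax = assms(19)
  have pos: "\<forall>\<^sub>F h :: real in at_top. h > 0" by (rule eventually_gt_at_top)
  have \<mu>: "\<forall>\<^sub>F h in at_top. \<mu> h \<in> prob_measures"
    using pos by eventually_elim (rule assms(17))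
  have "\<forall>\<^sub>F h in at_top. generates c (thickening \<Lambda> h) (Sh h)"
    using pos by eventually_elim (rule assms(14))
  then have Sh: "((\<lambda>h. Sh h t f) \<longlongrightarrow> S t f) at_top" if "t \<ge> 0" for t f
    by (rule restricted_semigroup_convergence[OF assms(6,11) _ eventually_in_thickening that])
  have "\<exists>l. ((\<lambda>h. \<integral>\<omega>. f \<omega> \<partial>\<mu> h) \<longlongrightarrow> l) at_top" if f: "local_fun (apply_bcontfun f)"
    for f :: "('s, 'q) obs"
  proof -
    \<comment> \<open>The time \<open>t\<close> is chosen first, from \<open>f\<close> and
      \<open>e\<close> alone, because \<open>C f * F t\<close> does not involve \<open>h\<close>;
      then \<open>h\<close> is taken large for this \<open>t\<close>. Each integral is within
      \<open>e / 4 + e / 4\<close> of \<open>S t f \<eta>\<close>, so any two differ by less than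
      \<open>e\<close>.\<close>
    have "\<exists>P. eventually P at_top \<and>
        (\<forall>h h'. P h \<and> P h' \<longrightarrow> dist (\<integral>\<omega>. f \<omega> \<partial>\<mu> h) (\<integral>\<omega>. f \<omega> \<partial>\<mu> h') < e)"
      if e: "e > 0" for e :: real
    proof -
      have e4: "e / 4 > 0" using e by simp
      have "((\<lambda>t. C f * F t) \<longlongrightarrow> 0) at_top"
        using tendsto_mult_right_zero[OF assms(16)] .
      then have "\<forall>\<^sub>F t in at_top. dist (C f * F t) 0 < e / 4"
        using e4 by (rule tendstoD)
      with eventually_ge_at_top[of 0] have "\<forall>\<^sub>F t in at_top. 0 \<le> t \<and> dist (C f * F t) 0 < e / 4"
        by eventually_elim simp
      then obtain t where t: "t \<ge> 0" "C f * F t < e / 4"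
        by (force dest: eventually_happens simp: dist_real_def)
      define P where "P h \<longleftrightarrow> h > 0 \<and> dist (Sh h t f) (S t f) < e / 4" for h
      have "dist (\<integral>\<omega>. f \<omega> \<partial>\<mu> h) (S t f \<eta>) < e / 2" if "P h" for h
      proof -
        have "dist (Sh h t f \<eta>) (S t f \<eta>) < e / 4"
          using that dist_bounded[of "Sh h t f" \<eta> "S t f"] by (simp add: P_def)
        moreover have "\<bar>Sh h t f \<eta> - (\<integral>\<omega>. f \<omega> \<partial>\<mu> h)\<bar> < e / 4"
          using relax[OF _ f t(1), of h] t(2) that by (simp add: P_def)
        ultimately show ?thesis unfolding dist_real_def by linarith
      qed
      then have "dist (\<integral>\<omega>. f \<omega> \<partial>\<mu> h) (\<integral>\<omega>. f \<omega> \<partial>\<mu> h') < e" if "P h" "P h'" for h h'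
        using that by (metis dist_triangle_half_l)
      moreover have "eventually P at_top"
        using pos tendstoD[OF Sh[OF t(1)] e4] unfolding P_def by eventually_elim simp
      ultimately show ?thesis by blast
    qed
    then have "cauchy_filter (filtermap (\<lambda>h. \<integral>\<omega>. f \<omega> \<partial>\<mu> h) at_top)"
      by (simp add: cauchy_filter_metric_filtermap)
    then have "\<exists>l. filtermap (\<lambda>h. \<integral>\<omega>. f \<omega> \<partial>\<mu> h) at_top \<le> nhds l"
      by (rule cauchy_filter_complete_converges[OF _ complete_UNIV])
         (simp_all add: filtermap_bot_iff)
    then show ?thesis by (simp add: filterlim_def)
  qed
  then obtain \<nu> where \<nu>: "\<nu> \<in> prob_measures" and conv: "weakly_converges \<mu> \<nu> at_top"
    using weak_limit_exists[OF trivial_limit_at_top_linorder \<mu>] by blast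
  have "(\<integral>\<omega>. f \<omega> \<partial>\<nu>) = (\<integral>\<omega>. S t f \<omega> \<partial>\<nu>)" if t: "t \<ge> 0" for t and f :: "('s, 'q) obs"
  proof (rule tendsto_unique[OF trivial_limit_at_top_linorder])
    show "((\<lambda>h. \<integral>\<omega>. f \<omega> \<partial>\<mu> h) \<longlongrightarrow> (\<integral>\<omega>. f \<omega> \<partial>\<nu>)) at_top"
      using conv by (simp add: weakly_converges_def)
    \<comment> \<open>The measures vary with \<open>h\<close> as well, so norm convergence of
      \<open>Sh h t f\<close> is used: it bounds the difference of integrals against any probability
      measure.\<close>
    have "((\<lambda>h. (\<integral>\<omega>. Sh h t f \<omega> \<partial>\<mu> h) - (\<integral>\<omega>. S t f \<omega> \<partial>\<mu> h)) \<longlongrightarrow> 0) at_top"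
    proof (rule Lim_null_comparison)
      show "\<forall>\<^sub>F h in at_top. norm ((\<integral>\<omega>. Sh h t f \<omega> \<partial>\<mu> h) - (\<integral>\<omega>. S t f \<omega> \<partial>\<mu> h))
          \<le> norm (Sh h t f - S t f)"
        using \<mu> by eventually_elim (simp add: integral_obs_diff)
      show "((\<lambda>h. norm (Sh h t f - S t f)) \<longlongrightarrow> 0) at_top"
        by (intro tendsto_norm_zero LIM_zero Sh t)
    qed
    moreover have "((\<lambda>h. \<integral>\<omega>. S t f \<omega> \<partial>\<mu> h) \<longlongrightarrow> (\<integral>\<omega>. S t f \<omega> \<partial>\<nu>)) at_top"
      using conv by (simp add: weakly_converges_def)
    ultimately have "((\<lambda>h. \<integral>\<omega>. Sh h t f \<omega> \<partial>\<mu> h) \<longlongrightarrow> (\<integral>\<omega>. S t f \<omega> \<partial>\<nu>)) at_top"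
      by (rule Lim_transform[rotated])
    \<comment> \<open>Stationarity of \<open>\<mu> h\<close> under \<open>Sh h\<close> removes the
      semigroup before the limit is taken, so both integrals against \<open>\<nu>\<close> are limits
      of the same function of \<open>h\<close>.\<close>
    moreover have "\<forall>\<^sub>F h in at_top. (\<integral>\<omega>. Sh h t f \<omega> \<partial>\<mu> h) = (\<integral>\<omega>. f \<omega> \<partial>\<mu> h)"
      using pos
    proof eventually_elim
      case (elim h)
      have "\<forall>f. (\<integral>\<omega>. apply_bcontfun f \<omega> \<partial>\<mu> h) = (\<integral>\<omega>. Sh h t f \<omega> \<partial>\<mu> h)"
        using assms(18)[OF elim] t unfolding stationary_def law_after_def by blast
      from this[THEN spec, of f] show ?case by (rule sym)
    qed
    ultimately show "((\<lambda>h. \<integral>\<omega>. f \<omega> \<partial>\<mu> h) \<longlongrightarrow> (\<integral>\<omega>. S t f \<omega> \<partial>\<nu>)) at_top"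
      by (rule Lim_transform_eventually)
  qed
  then have "stationary S \<nu>"
    using \<nu> unfolding stationary_def law_after_def by blast
  with \<nu> conv show ?thesis by blast
qed

end
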